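(* Let $1\le p<\infty$, $N,M\in\mathbb N$, and let $\Theta$ be a suitable set of moduli of continuity. The map $$\Pi:\mathbb R\times \Theta\mathfrak C_p(\mathbb R^M)\to \Theta\mathfrak C_p(\mathbb R^M),\qquad (t,f)\mapsto \Pi(t,f)=f_t,\qquad f_t(s,x)=f(s+t,x),$$ defines a continuous flow on $\big(\Theta\mathfrak C_p(\mathbb R^M),\mathcal T_\Theta\big)$.
   Context: $B_j$ is the closed ball of radius $j$ centered at $0$ in $\mathbb R^N$. $L^p_{loc}$ is the set of functions $\mathbb R\to\mathbb R$ belonging to $L^p(I)$ for every compact interval $I$. A suitable set of moduli of continuity is a countable set of non-decreasing continuous functions $\Theta=\{\theta^I_j:[0,\infty)\to[0,\infty)\mid j\in\mathbb N,\ I=[q_1,q_2],\ q_1,q_2\in\mathbb Q\}$ with $\theta^I_j(0)=0$ for all $I,j$ and $\theta^{I_1}_{j_1}\le\theta^{I_2}_{j_2}$ whenever $I_1\subseteq I_2$ and $j_1\le j_2$. $\mathcal K^I_j$ is the set of continuous functions $I\to B_j$ admitting $\theta^I_j$ as modulus of continuity. $\Theta\mathfrak C_p(\mathbb R^M)$ is the set of functions $f:\mathbb R\times\mathbb R^N\to\mathbb R^M$ such that: (C1) $f$ is Borel measurable; (C2) for every compact $K\subset\mathbb R^N$ there is $m^K\in L^p_{loc}$ with $|f(t,x)|\le m^K(t)$ for a.e. $t\in\mathbb R$ and all $x\in K$; (T) for each $j\in\mathbb N$ and $I=[q_1,q_2]$ with $q_1,q_2\in\mathbb Q$, if $(x_n)$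 is a sequence in $\mathcal K^I_j$ converging uniformly to $x\in\mathcal K^I_j$, then $\lim_{n\to\infty}\int_I|f(t,x_n(t))-f(t,x(t))|^p\,dt=0$. Two functions of $\Theta\mathfrak C_p(\mathbb R^M)$ that differ only on a Lebesgue-null subset of $\mathbb R^{1+N}$ are identified. $\mathcal T_\Theta$ is the (metrizable, locally convex) topology on $\Theta\mathfrak C_p(\mathbb R^M)$ generated by the seminorms $p_{I,j}(f)=\sup_{x(\cdot)\in\mathcal K^I_j}\big[\int_I|f(t,x(t))|^p\,dt\big]^{1/p}$, with $I=[q_1,q_2]$, $q_1,q_2\in\mathbb Q$, $j\in\mathbb N$. A continuous flow on a topological space $X$ is a continuous map $\Pi:\mathbb R\times X\to X$ with $\Pi(0,\cdot)=\mathrm{id}$ and $\Pi(t+s,\cdot)=\Pi(t,\Pi(s,\cdot))$ for all $s,t\in\mathbb R$. *)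

theory Defs
  imports "HOL-Analysis.Analysis"
begin

definition rational_intervals :: "real set set" where
  "rational_intervals = {{q1..q2} | q1 q2. q1 \<in> \<rat> \<and> q2 \<in> \<rat> \<and> q1 \<le> q2}"

text \<open>A family of moduli is indexed by the interval and by \<open>j\<close>; the index set of \<open>j\<close> is the
  positive integers, and only values at nonnegative reals matter.\<close>

definition suitable_moduli :: "(real set \<Rightarrow> nat \<Rightarrow> real \<Rightarrow> real) \<Rightarrow> bool" where
  "suitable_moduli \<theta> \<longleftrightarrow>
    (\<forall>I\<in>rational_intervals. \<forall>j\<ge>1.
        continuous_on {0..} (\<theta> I j) \<and> mono_on {0..} (\<theta> I j) \<and>
        (\<forall>s\<ge>0. \<theta> I j s \<ge> 0) \<and> \<theta> I j 0 = 0) \<and>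
    (\<forall>I1\<in>rational_intervals. \<forall>I2\<in>rational_intervals. \<forall>j1\<ge>1. \<forall>j2\<ge>1.
        I1 \<subseteq> I2 \<and> j1 \<le> j2 \<longrightarrow> (\<forall>s\<ge>0. \<theta> I1 j1 s \<le> \<theta> I2 j2 s))"

text \<open>Functions on \<open>I\<close> are represented by total functions; their values outside \<open>I\<close> are
  unconstrained and are never used below.\<close>

definition modulus_class ::
    "(real set \<Rightarrow> nat \<Rightarrow> real \<Rightarrow> real) \<Rightarrow> real set \<Rightarrow> nat \<Rightarrow> (real \<Rightarrow> real^'n) set" where
  "modulus_class \<theta> I j =
    {x. continuous_on I x \<and> x ` I \<subseteq> cball 0 (real j) \<and>
        (\<forall>s\<in>I. \<forall>t\<in>I. norm (x s - x t) \<le> \<theta> I j \<bar>s - t\<bar>)}"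

definition Lp_loc :: "real \<Rightarrow> (real \<Rightarrow> real) set" where
  "Lp_loc p = {m. \<forall>a b. set_borel_measurable lebesgue {a..b} m \<and>
                        set_integrable lebesgue {a..b} (\<lambda>t. \<bar>m t\<bar> powr p)}"

text \<open>The three conjuncts are (C1), (C2) and (T). By the first two, the integrands in the third
  one (and in the seminorms below) are integrable over \<open>I\<close>, so that the convention that the
  Bochner integral of a non-integrable function is \<open>0\<close> plays no role.\<close>

definition Theta_C ::
    "real \<Rightarrow> (real set \<Rightarrow> nat \<Rightarrow> real \<Rightarrow> real) \<Rightarrow> (real \<times> (real^'n) \<Rightarrow> real^'m) set" where
  "Theta_C p \<theta> =
    {f. f \<in> borel_measurable borel \<and>
        (\<forall>K. compact K \<longrightarrow>
          (\<exists>m\<in>Lp_loc p. AE t in lebesgue. \<forall>x\<in>K. norm (f (t, x)) \<le> m t)) \<and>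
        (\<forall>I\<in>rational_intervals. \<forall>j\<ge>1. \<forall>xs. \<forall>x\<in>modulus_class \<theta> I j.
          (\<forall>n. xs n \<in> modulus_class \<theta> I j) \<and> uniform_limit I xs x sequentially \<longrightarrow>
          (\<lambda>n. LINT t:I|lebesgue. norm (f (t, xs n t) - f (t, x t)) powr p) \<longlonglongrightarrow> 0)}"

definition Theta_seminorm ::
    "real \<Rightarrow> (real set \<Rightarrow> nat \<Rightarrow> real \<Rightarrow> real) \<Rightarrow> real set \<Rightarrow> nat \<Rightarrow>
      (real \<times> (real^'n) \<Rightarrow> real^'m) \<Rightarrow> real" where
  "Theta_seminorm p \<theta> I j f =
    (SUP x\<in>modulus_class \<theta> I j. (LINT t:I|lebesgue. norm (f (t, x t)) powr p) powr (1 / p))"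

definition Theta_rel ::
    "real \<Rightarrow> (real set \<Rightarrow> nat \<Rightarrow> real \<Rightarrow> real) \<Rightarrow>
      ((real \<times> (real^'n) \<Rightarrow> real^'m) \<times> (real \<times> (real^'n) \<Rightarrow> real^'m)) set" where
  "Theta_rel p \<theta> =
    {(f, g). f \<in> Theta_C p \<theta> \<and> g \<in> Theta_C p \<theta> \<and> (AE z in lebesgue. f z = g z)}"

definition Theta_class ::
    "real \<Rightarrow> (real set \<Rightarrow> nat \<Rightarrow> real \<Rightarrow> real) \<Rightarrow> (real \<times> (real^'n) \<Rightarrow> real^'m) \<Rightarrow>
      (real \<times> (real^'n) \<Rightarrow> real^'m) set" where
  "Theta_class p \<theta> f = Theta_rel p \<theta> `` {f}"

text \<open>The topology lives on the quotient of \<open>Theta_C p \<theta>\<close> by \<open>Theta_rel p \<theta>\<close>. Its subbasis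
  consists of the open seminorm balls around the class of \<open>f\<close>. The seminorms do not depend on the
  representative (by (T) and Fubini, applied to small constant shifts of slightly shrunk curves), so that the
  existential quantifier over \<open>g \<in> A\<close> could equally be a universal one.\<close>

definition Theta_topology ::
    "real \<Rightarrow> (real set \<Rightarrow> nat \<Rightarrow> real \<Rightarrow> real) \<Rightarrow>
      (real \<times> (real^'n) \<Rightarrow> real^'m) set topology" where
  "Theta_topology p \<theta> = topology_generated_by
    {{A \<in> Theta_C p \<theta> // Theta_rel p \<theta>. \<exists>g\<in>A. Theta_seminorm p \<theta> I j (\<lambda>z. g z - f z) < \<epsilon>}
      | f I j \<epsilon>. f \<in> Theta_C p \<theta> \<and> I \<in> rational_intervals \<and> 1 \<le> j \<and> 0 < \<epsilon>}"

definition time_translate :: "real \<Rightarrow> (real \<times> (real^'n) \<Rightarrow> real^'m) \<Rightarrow> (real \<times> (real^'n) \<Rightarrow> real^'m)"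
  where "time_translate t f = (\<lambda>(s, x). f (s + t, x))"

definition translation_map ::
    "real \<Rightarrow> (real set \<Rightarrow> nat \<Rightarrow> real \<Rightarrow> real) \<Rightarrow>
      real \<times> (real \<times> (real^'n) \<Rightarrow> real^'m) set \<Rightarrow> (real \<times> (real^'n) \<Rightarrow> real^'m) set" where
  "translation_map p \<theta> = (\<lambda>(t, A). \<Union>f\<in>A. Theta_class p \<theta> (time_translate t f))"

definition continuous_flow :: "'a topology \<Rightarrow> (real \<times> 'a \<Rightarrow> 'a) \<Rightarrow> bool" where
  "continuous_flow X \<Phi> \<longleftrightarrow>
    continuous_map (prod_topology euclideanreal X) X \<Phi> \<and>
    (\<forall>x\<in>topspace X. \<Phi> (0, x) = x) \<and>
    (\<forall>t s. \<forall>x\<in>topspace X. \<Phi> (t + s, x) = \<Phi> (t, \<Phi> (s, x)))"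

lemma equiv_Theta_rel: "equiv (Theta_C p \<theta>) (Theta_rel p \<theta>)"
proof (intro equivI symI transI refl_onI)
  show "Theta_rel p \<theta> \<subseteq> Theta_C p \<theta> \<times> Theta_C p \<theta>"
    by (auto simp: Theta_rel_def)
next
  fix f :: "real \<times> (real^'n) \<Rightarrow> real^'m" assume "f \<in> Theta_C p \<theta>"
  then show "(f, f) \<in> Theta_rel p \<theta>"
    by (simp add: Theta_rel_def)
next
  fix f g :: "real \<times> (real^'n) \<Rightarrow> real^'m" assume "(f, g) \<in> Theta_rel p \<theta>"
  then show "(g, f) \<in> Theta_rel p \<theta>"
    by (auto simp: Theta_rel_def elim: eventually_mono)
next
  fix f g h :: "real \<times> (real^'n) \<Rightarrow> real^'m"
  assume "(f, g) \<in> Theta_rel p \<theta>" "(g, h) \<in> Theta_rel p \<theta>"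
  then show "(f, h) \<in> Theta_rel p \<theta>"
    by (auto simp: Theta_rel_def elim: eventually_elim2)
qed

lemma zero_in_modulus_class:
  assumes "suitable_moduli \<theta>" "I \<in> rational_intervals" "1 \<le> j"
  shows "(\<lambda>_. 0) \<in> modulus_class \<theta> I j"
  using assms by (auto simp: modulus_class_def suitable_moduli_def)

lemma topspace_Theta_topology:
  assumes "suitable_moduli \<theta>"
  shows "topspace (Theta_topology p \<theta> :: (real \<times> (real^'n) \<Rightarrow> real^'m) set topology) =
    Theta_C p \<theta> // Theta_rel p \<theta>"
proof -
  have I: "{0..1::real} \<in> rational_intervals"
    unfolding rational_intervals_def
    by (intro CollectI exI[of _ "0::real"] exI[of _ "1::real"]) simp
  have ne: "(modulus_class \<theta> {0..1} 1 :: (real \<Rightarrow> real^'n) set) \<noteq> {}"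
    using zero_in_modulus_class[OF assms I] by blast
  have zero: "Theta_seminorm p \<theta> {0..1} 1 (\<lambda>z. f z - f z) = 0"
    for f :: "real \<times> (real^'n) \<Rightarrow> real^'m"
    using ne by (simp add: Theta_seminorm_def set_lebesgue_integral_def)
  have "A \<in> \<Union>{{A \<in> Theta_C p \<theta> // Theta_rel p \<theta>.
        \<exists>g\<in>A. Theta_seminorm p \<theta> I j (\<lambda>z. g z - f z) < \<epsilon>}
      | f I j \<epsilon>. f \<in> Theta_C p \<theta> \<and> I \<in> rational_intervals \<and> 1 \<le> j \<and> 0 < \<epsilon>}"
    if A: "A \<in> Theta_C p \<theta> // Theta_rel p \<theta>" for A :: "(real \<times> (real^'n) \<Rightarrow> real^'m) set"
  proof -
    obtain f where f: "f \<in> Theta_C p \<theta>" "f \<in> A"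
      using A equiv_Theta_rel by (metis equiv_class_self quotientE)
    have "A \<in> {A \<in> Theta_C p \<theta> // Theta_rel p \<theta>.
        \<exists>g\<in>A. Theta_seminorm p \<theta> {0..1} 1 (\<lambda>z. g z - f z) < 1}"
      using A f zero[of f] by (auto intro!: bexI[of _ f])
    then show ?thesis
      using f I by (intro UnionI[of "{A \<in> Theta_C p \<theta> // Theta_rel p \<theta>.
        \<exists>g\<in>A. Theta_seminorm p \<theta> {0..1} 1 (\<lambda>z. g z - f z) < 1}"])
        (auto intro!: exI[of _ f] exI[of _ "{0..1}"] exI[of _ "1::nat"] exI[of _ "1::real"])
  qed
  then show ?thesis
    unfolding Theta_topology_def topology_generated_by_topspace by blast
qed

end

theory Submission
  imports Defs "HOL-Complex_Analysis.Great_Picard"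
begin

text \<open>Write \<open>f_t\<close> for the translate of \<open>f\<close> by \<open>t\<close>, and \<open>K(I, j)\<close> for the curves with values in the
  ball of radius \<open>j\<close> that have the modulus of continuity for \<open>I\<close> and \<open>j\<close>. For a curve \<open>x\<close> in
  \<open>K(I, j)\<close>, the values \<open>f_t (s, x s)\<close> for \<open>s\<close> in \<open>I\<close> are the values \<open>f (u, x (u - t))\<close> for \<open>u\<close> in
  \<open>I + t\<close>, so \<open>f\<close> is evaluated along a curve on the translated interval. The end points
  of \<open>I + t\<close> need not be rational, but the shifted curve, continued by its boundary values, lies in
  \<open>K(J, j)\<close> for every rational interval \<open>J\<close> that contains \<open>I\<close> and \<open>I + t\<close>, because moduli
  increase with the interval (\<open>shifted_curve_modulus_class\<close>). So translation preserves the function space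
  (\<open>Theta_C_translate\<close>), and the seminorm of \<open>f_t\<close> for \<open>I\<close> is at most that of \<open>f\<close> for
  \<open>J\<close> (\<open>Theta_seminorm_translate_le\<close>). As \<open>J\<close> can be chosen for all \<open>t\<close> in a bounded set, translations
  are locally equicontinuous.

  It remains to see that \<open>f_t\<close> tends to \<open>f\<close> as \<open>t\<close> tends to \<open>0\<close>, uniformly along the curves of
  \<open>K(I, j)\<close> (\<open>Theta_seminorm_translate_small\<close>). By the theorem of Arzela and Ascoli this set is compact for
  uniform convergence, so it suffices to take times \<open>\<tau> n\<close> tending to \<open>0\<close> and curves \<open>xs n\<close> converging to
  some \<open>x\<close>. The third condition on \<open>f\<close> permits to replace \<open>xs n\<close> by \<open>x\<close>, at time \<open>s\<close> as well as
  at time \<open>s + \<tau> n\<close>, and then only the translates of the single \<open>p\<close>-integrable function \<open>f (u, x u)\<close>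
  are compared; translation is continuous in the mean (\<open>Lp_translation_continuous\<close>).

  Equicontinuity and continuity in time together give joint continuity. The algebraic flow properties
  are immediate once translation is seen to respect equality almost everywhere.\<close>

section \<open>Translation invariance of Lebesgue measure\<close>

lemma
  fixes c :: "'a::euclidean_space"
  shows measurable_lebesgue_translate: "(\<lambda>z. z + c) \<in> lebesgue \<rightarrow>\<^sub>M lebesgue"
    and distr_lebesgue_translate: "distr lebesgue lebesgue (\<lambda>z. z + c) = lebesgue"
proof -
  have "(\<lambda>z. c + (\<Sum>i\<in>Basis. (1 * (z \<bullet> i)) *\<^sub>R i)) = (\<lambda>z. z + c)"
    by (simp add: euclidean_representation fun_eq_iff)
  then show "(\<lambda>z. z + c) \<in> lebesgue \<rightarrow>\<^sub>M lebesgue" "distr lebesgue lebesgue (\<lambda>z. z + c) = lebesgue"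
    using lebesgue_affine_measurable[of "\<lambda>_. 1" c] lebesgue_affine_euclidean[of "\<lambda>_. 1" c]
    by (simp_all add: density_1)
qed

lemma AE_lebesgue_translate:
  fixes c :: "'a::euclidean_space"
  assumes "AE z in lebesgue. P z"
  shows "AE z in lebesgue. P (z + c)"
proof (rule AE_distrD[OF measurable_lebesgue_translate])
  show "AE z in distr lebesgue lebesgue (\<lambda>z. z + c). P z"
    unfolding distr_lebesgue_translate by (fact assms)
qed

lemma indicator_translate: "indicator {a + t..b + t} (s + t) = (indicator {a..b} s :: real)" for s t :: real
  by (simp add: indicator_def)

lemma set_borel_measurable_translate:
  fixes F :: "real \<Rightarrow> 'a::real_normed_vector"
  assumes "set_borel_measurable lebesgue {a + t..b + t} F"
  shows "set_borel_measurable lebesgue {a..b} (\<lambda>s. F (s + t))"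
  using measurable_compose[OF measurable_lebesgue_translate[of t] assms[unfolded set_borel_measurable_def]]
  by (simp add: set_borel_measurable_def indicator_translate)

lemma set_integrable_translate:
  fixes F :: "real \<Rightarrow> 'a::{banach, second_countable_topology}"
  assumes "set_integrable lebesgue {a + t..b + t} F"
  shows "set_integrable lebesgue {a..b} (\<lambda>s. F (s + t))"
proof -
  have "integrable (distr lebesgue lebesgue (\<lambda>s. s + t)) (\<lambda>u. indicator {a + t..b + t} u *\<^sub>R F u)"
    using assms unfolding distr_lebesgue_translate set_integrable_def .
  from integrable_distr[OF measurable_lebesgue_translate[of t] this] show ?thesis
    by (simp add: set_integrable_def indicator_translate)
qed

lemma set_integral_translate:
  fixes F :: "real \<Rightarrow> 'a::{banach, second_countable_topology}"
  assumes "set_borel_measurable lebesgue {a + t..b + t} F"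
  shows "(LINT s:{a..b}|lebesgue. F (s + t)) = (LINT u:{a + t..b + t}|lebesgue. F u)"
  using integral_distr[OF measurable_lebesgue_translate[of t] assms[unfolded set_borel_measurable_def]]
  by (simp add: set_lebesgue_integral_def indicator_translate distr_lebesgue_translate)

section \<open>Functions that are \<open>p\<close>-integrable over a compact interval\<close>

abbreviation Lp_int :: "real \<Rightarrow> real \<Rightarrow> real \<Rightarrow> (real \<Rightarrow> 'a::real_normed_vector) \<Rightarrow> real" where
  "Lp_int p a b F \<equiv> LINT s:{a..b}|lebesgue. norm (F s) powr p"

text \<open>Borel measurability is asked for on the whole line, so that translates of a member are
  measurable as well; integrability is local.\<close>

definition Lp_on :: "real \<Rightarrow> real \<Rightarrow> real \<Rightarrow> (real \<Rightarrow> 'a::euclidean_space) set" where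
  "Lp_on p a b = {F. F \<in> borel_measurable borel \<and>
     set_integrable lebesgue {a..b} (\<lambda>s. norm (F s) powr p)}"

lemma borel_imp_lebesgue_measurable:
  "F \<in> borel_measurable borel \<Longrightarrow> F \<in> borel_measurable lebesgue"
  by (rule measurable_completion) simp

lemma Lp_on_measurable: "F \<in> Lp_on p a b \<Longrightarrow> F \<in> borel_measurable borel"
  by (simp add: Lp_on_def)

lemma Lp_on_integrable:
  "F \<in> Lp_on p a b \<Longrightarrow> set_integrable lebesgue {a..b} (\<lambda>s. norm (F s) powr p)"
  by (simp add: Lp_on_def)

lemma powr_norm_set_borel_measurable:
  fixes F :: "real \<Rightarrow> 'a::euclidean_space"
  assumes "F \<in> borel_measurable lebesgue"
  shows "set_borel_measurable lebesgue {a..b} (\<lambda>s. norm (F s) powr p)"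
proof -
  have "(\<lambda>v::'a. norm v powr p) \<in> borel_measurable borel" by measurable
  from measurable_compose[OF assms this] show ?thesis
    unfolding set_borel_measurable_def
    by (intro borel_measurable_scaleR borel_measurable_indicator) auto
qed

lemma Lp_on_dominated:
  fixes F :: "real \<Rightarrow> 'a::euclidean_space" and w :: "real \<Rightarrow> real"
  assumes "F \<in> borel_measurable borel" "set_integrable lebesgue {a..b} w"
    and "AE s in lebesgue. s \<in> {a..b} \<longrightarrow> norm (F s) powr p \<le> w s"
  shows "F \<in> Lp_on p a b"
proof -
  have "set_integrable lebesgue {a..b} (\<lambda>s. norm (F s) powr p)"
  proof (rule set_integrable_bound[OF assms(2)])
    show "set_borel_measurable lebesgue {a..b} (\<lambda>s. norm (F s) powr p)"
      by (rule powr_norm_set_borel_measurable[OF borel_imp_lebesgue_measurable[OF assms(1)]])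
    show "AE s in lebesgue. s \<in> {a..b} \<longrightarrow> norm (norm (F s) powr p) \<le> norm (w s)"
      using assms(3) by eventually_elim auto
  qed
  then show ?thesis using assms(1) by (simp add: Lp_on_def)
qed

lemma set_integrable_const_interval: "set_integrable lebesgue {a..b::real} (\<lambda>_. c::real)"
proof -
  have "integrable lebesgue (indicator {a..b} :: real \<Rightarrow> real)"
    by (rule integrable_real_indicator) (auto simp: emeasure_lborel_Icc_eq)
  then show ?thesis by (simp add: set_integrable_def)
qed

lemma Lp_on_bounded:
  fixes F :: "real \<Rightarrow> 'a::euclidean_space"
  assumes "0 \<le> p" "F \<in> borel_measurable borel" "\<And>s. s \<in> {a..b} \<Longrightarrow> norm (F s) \<le> B"
  shows "F \<in> Lp_on p a b"
  by (rule Lp_on_dominated[OF assms(2) set_integrable_const_interval[of a b "B powr p"]])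
    (auto intro!: powr_mono2 assms)

lemma Lp_on_subset:
  assumes "F \<in> Lp_on p a b" "{c..d} \<subseteq> {a..b}"
  shows "F \<in> Lp_on p c d"
  using assms set_integrable_subset[of lebesgue "{a..b}" _ "{c..d}"] by (auto simp: Lp_on_def)

lemma Lp_int_mono_set:
  assumes "F \<in> Lp_on p a b" "{c..d} \<subseteq> {a..b}"
  shows "Lp_int p c d F \<le> Lp_int p a b F"
  unfolding set_lebesgue_integral_def
proof (rule integral_mono)
  show "integrable lebesgue (\<lambda>s. indicator {c..d} s *\<^sub>R norm (F s) powr p)"
    "integrable lebesgue (\<lambda>s. indicator {a..b} s *\<^sub>R norm (F s) powr p)"
    using Lp_on_integrable[OF Lp_on_subset[OF assms]] Lp_on_integrable[OF assms(1)]
    by (auto simp: set_integrable_def)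
  show "indicator {c..d} s *\<^sub>R norm (F s) powr p \<le> indicator {a..b} s *\<^sub>R norm (F s) powr p" for s
    using assms(2) by (auto simp: indicator_def)
qed

lemma Lp_int_nonneg: "0 \<le> Lp_int p a b F"
  unfolding set_lebesgue_integral_def by (intro integral_nonneg_AE) auto

lemma Lp_on_translate:
  assumes "F \<in> Lp_on p (a + t) (b + t)"
  shows "(\<lambda>s. F (s + t)) \<in> Lp_on p a b"
proof -
  have "F \<in> borel_measurable borel" by (rule Lp_on_measurable[OF assms])
  then have "(\<lambda>s. F (s + t)) \<in> borel_measurable borel" by measurable
  then show ?thesis
    using set_integrable_translate[OF Lp_on_integrable[OF assms]] by (simp add: Lp_on_def)
qed

lemma Lp_int_translate:
  fixes F :: "real \<Rightarrow> 'a::euclidean_space"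
  assumes "F \<in> borel_measurable borel"
  shows "Lp_int p a b (\<lambda>s. F (s + t)) = Lp_int p (a + t) (b + t) F"
  by (rule set_integral_translate[OF powr_norm_set_borel_measurable])
    (rule borel_imp_lebesgue_measurable[OF assms])

lemma norm_add3_powr_le:
  fixes u v w :: "'a::real_normed_vector"
  assumes "0 \<le> p"
  shows "norm (u + v + w) powr p \<le> 3 powr p * (norm u powr p + norm v powr p + norm w powr p)"
proof -
  define m where "m = max (norm u) (max (norm v) (norm w))"
  have "norm (u + v + w) \<le> 3 * m"
    using norm_triangle_ineq[of "u + v" w] norm_triangle_ineq[of u v] by (auto simp: m_def)
  then have "norm (u + v + w) powr p \<le> (3 * m) powr p"
    by (intro powr_mono2 assms) auto
  also have "\<dots> = 3 powr p * m powr p"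
    by (simp add: powr_mult m_def)
  also have "m powr p \<le> norm u powr p + norm v powr p + norm w powr p"
    by (auto simp: m_def max_def)
  finally show ?thesis by simp
qed

lemma Lp_on_add3:
  assumes "0 \<le> p" "F \<in> Lp_on p a b" "G \<in> Lp_on p a b" "H \<in> Lp_on p a b"
  shows "(\<lambda>s. F s + G s + H s) \<in> Lp_on p a b"
proof (rule Lp_on_dominated)
  show "(\<lambda>s. F s + G s + H s) \<in> borel_measurable borel"
    using assms(2-4)[THEN Lp_on_measurable] by measurable
  show "set_integrable lebesgue {a..b}
      (\<lambda>s. 3 powr p * (norm (F s) powr p + norm (G s) powr p + norm (H s) powr p))"
    by (intro set_integrable_mult_right set_integral_add Lp_on_integrable assms)
qed (use norm_add3_powr_le[OF assms(1)] in auto)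

lemma Lp_on_add:
  assumes "0 \<le> p" "F \<in> Lp_on p a b" "G \<in> Lp_on p a b"
  shows "(\<lambda>s. F s + G s) \<in> Lp_on p a b"
  using Lp_on_add3[OF assms Lp_on_bounded[of p "\<lambda>_. 0" a b 0]] assms(1) by simp

lemma Lp_on_diff:
  assumes "0 \<le> p" "F \<in> Lp_on p a b" "G \<in> Lp_on p a b"
  shows "(\<lambda>s. F s - G s) \<in> Lp_on p a b"
proof -
  have "(\<lambda>s. - G s) \<in> Lp_on p a b" using assms(3) by (auto simp: Lp_on_def)
  from Lp_on_add[OF assms(1,2) this] show ?thesis by simp
qed

lemma Lp_int_add3_le:
  assumes "0 \<le> p" "F \<in> Lp_on p a b" "G \<in> Lp_on p a b" "H \<in> Lp_on p a b"
  shows "Lp_int p a b (\<lambda>s. F s + G s + H s) \<le>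
    3 powr p * (Lp_int p a b F + Lp_int p a b G + Lp_int p a b H)"
proof -
  note int = assms(2-4)[THEN Lp_on_integrable]
  have "Lp_int p a b (\<lambda>s. F s + G s + H s) \<le>
      (LINT s:{a..b}|lebesgue. 3 powr p * (norm (F s) powr p + norm (G s) powr p + norm (H s) powr p))"
    by (intro set_integral_mono Lp_on_integrable Lp_on_add3 assms set_integrable_mult_right
        set_integral_add(1) norm_add3_powr_le)
  also have "\<dots> = 3 powr p * (Lp_int p a b F + Lp_int p a b G + Lp_int p a b H)"
    using int by simp
  finally show ?thesis .
qed

text \<open>Convexity of \<open>x powr p\<close> at the convex combination \<open>u + v = (A + B) * (l * (u / A) + m * (v / B))\<close>
  with \<open>l = A / (A + B)\<close> and \<open>m = B / (A + B)\<close>. The weights are such that integration yields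
  Minkowski's inequality at once, with \<open>A\<close> and \<open>B\<close> as bounds of the two norms.\<close>

lemma convex_powr_Minkowski:
  fixes A B u v :: real
  assumes "1 \<le> p" "0 < A" "0 < B" "0 \<le> u" "0 \<le> v"
  shows "(u + v) powr p \<le>
    (A + B) powr p * (A / (A + B) * (u / A) powr p + B / (A + B) * (v / B) powr p)"
proof -
  define l m where "l = A / (A + B)" and "m = B / (A + B)"
  have lm: "0 < l" "0 < m" "l + m = 1"
  proof -
    show "0 < l" "0 < m" using assms by (simp_all add: l_def m_def)
    have "l + m = (A + B) / (A + B)" unfolding l_def m_def by (rule add_divide_distrib[symmetric])
    also have "\<dots> = 1" using assms by simp
    finally show "l + m = 1" .
  qed
  have conv: "(l * x + m * y) powr p \<le> l * x powr p + m * y powr p" if "0 \<le> x" "0 \<le> y" for x y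
  proof (cases "x = 0 \<or> y = 0")
    case True
    \<comment> \<open>If \<open>x\<close> or \<open>y\<close> vanishes, one term is left, and \<open>l powr p \<le> l\<close>, \<open>m powr p \<le> m\<close>.\<close>
    have "l powr p \<le> l" "m powr p \<le> m" using lm assms(1) by (auto intro!: powr_le_one_le)
    with True show ?thesis
      using assms(1) that lm by (auto simp: powr_mult intro!: mult_right_mono)
  next
    case False
    have l_eq: "1 - m = l" using lm by simp
    show ?thesis
      using False convex_onD[OF powr_convex[OF assms(1)], of m x y] lm that
      by (simp add: l_eq)
  qed
  have "(A + B) * l = A" "(A + B) * m = B" using assms by (auto simp: l_def m_def)
  then have "u + v = (A + B) * (l * (u / A) + m * (v / B))"
    using assms by (metis distrib_left mult.assoc nonzero_mult_div_cancel_left order_less_irrefl times_divide_eq_right)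
  then have "(u + v) powr p = (A + B) powr p * (l * (u / A) + m * (v / B)) powr p"
    using assms lm by (simp add: powr_mult)
  also have "\<dots> \<le> (A + B) powr p * (l * (u / A) powr p + m * (v / B) powr p)"
    using assms by (intro mult_left_mono conv) auto
  finally show ?thesis by (simp add: l_def m_def)
qed

lemma Lp_int_Minkowski:
  assumes p: "1 \<le> p" and AB: "0 < A" "0 < B"
    and FG: "F \<in> Lp_on p a b" "G \<in> Lp_on p a b"
    and le: "Lp_int p a b F \<le> A powr p" "Lp_int p a b G \<le> B powr p"
  shows "Lp_int p a b (\<lambda>s. F s + G s) \<le> (A + B) powr p"
proof -
  define f where "f s = norm (F s) powr p" for s
  define g where "g s = norm (G s) powr p" for s
  have int: "set_integrable lebesgue {a..b} f" "set_integrable lebesgue {a..b} g"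
    using FG[THEN Lp_on_integrable] by (simp_all add: f_def[abs_def] g_def[abs_def])
  define c d where "c = A / (A + B) / A powr p" and "d = B / (A + B) / B powr p"
  have cd: "0 \<le> c" "0 \<le> d" using AB by (auto simp: c_def d_def)
  have "Lp_int p a b (\<lambda>s. F s + G s) \<le> (LINT s:{a..b}|lebesgue. (A + B) powr p * (c * f s + d * g s))"
  proof (rule set_integral_mono)
    show "set_integrable lebesgue {a..b} (\<lambda>s. norm (F s + G s) powr p)"
      using p by (intro Lp_on_integrable Lp_on_add FG) auto
    show "set_integrable lebesgue {a..b} (\<lambda>s. (A + B) powr p * (c * f s + d * g s))"
      by (intro set_integrable_mult_right set_integral_add int)
    fix s
    have "norm (F s + G s) powr p \<le> (norm (F s) + norm (G s)) powr p"
      using p by (intro powr_mono2 norm_triangle_ineq) auto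
    also have "\<dots> \<le> (A + B) powr p * (c * f s + d * g s)"
      using convex_powr_Minkowski[OF p AB norm_ge_zero[of "F s"] norm_ge_zero[of "G s"]] AB
      by (simp add: c_def d_def f_def g_def powr_divide)
    finally show "norm (F s + G s) powr p \<le> (A + B) powr p * (c * f s + d * g s)" .
  qed
  also have "\<dots> = (A + B) powr p * (c * (LINT s:{a..b}|lebesgue. f s) + d * (LINT s:{a..b}|lebesgue. g s))"
    using int by simp
  also have "\<dots> \<le> (A + B) powr p * (c * A powr p + d * B powr p)"
    using le cd by (intro mult_left_mono add_mono) (auto simp: f_def g_def)
  also have "c * A powr p + d * B powr p = 1"
    using AB by (simp add: c_def d_def add_divide_distrib[symmetric])
  finally show ?thesis by simp
qed

section \<open>Continuity of translations in the mean\<close>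

lemma Lp_int_tendsto_zero:
  fixes D :: "nat \<Rightarrow> real \<Rightarrow> 'a::euclidean_space"
  assumes "0 < p" "\<And>n. D n \<in> borel_measurable borel" "set_integrable lebesgue {a..b} w"
    and "\<And>n s. s \<in> {a..b} \<Longrightarrow> norm (D n s) powr p \<le> w s"
    and "AE s in lebesgue. s \<in> {a..b} \<longrightarrow> (\<lambda>n. D n s) \<longlonglongrightarrow> 0"
  shows "(\<lambda>n. Lp_int p a b (D n)) \<longlonglongrightarrow> 0"
proof -
  have "(\<lambda>n. LINT s|lebesgue. indicator {a..b} s *\<^sub>R norm (D n s) powr p)
      \<longlonglongrightarrow> (LINT s|(lebesgue :: real measure). 0 :: real)"
  proof (rule integral_dominated_convergence)
    show "integrable lebesgue (\<lambda>s. indicator {a..b} s *\<^sub>R w s)"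
      using assms(3) by (simp add: set_integrable_def)
    show "(\<lambda>s. indicator {a..b} s *\<^sub>R norm (D n s) powr p) \<in> borel_measurable lebesgue" for n
      using powr_norm_set_borel_measurable[OF borel_imp_lebesgue_measurable[OF assms(2)]]
      by (simp add: set_borel_measurable_def)
    show "AE s in lebesgue. (\<lambda>n. indicator {a..b} s *\<^sub>R norm (D n s) powr p) \<longlonglongrightarrow> 0"
      using assms(5)
    proof eventually_elim
      case (elim s)
      show ?case
      proof (cases "s \<in> {a..b}")
        case True
        then have "(\<lambda>n. norm (D n s)) \<longlonglongrightarrow> 0" using elim tendsto_norm_zero by blast
        then have "(\<lambda>n. norm (D n s) powr p) \<longlonglongrightarrow> 0 powr p"
          using assms(1) by (intro tendsto_powr2) auto
        then show ?thesis using True by simp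
      qed simp
    qed
    show "AE s in lebesgue. norm (indicator {a..b} s *\<^sub>R norm (D n s) powr p)
        \<le> indicator {a..b} s *\<^sub>R w s" for n
      using assms(4)[of _ n] by (intro AE_I2) (auto simp: indicator_def)
  qed simp
  then show ?thesis by (simp add: set_lebesgue_integral_def)
qed

text \<open>Radial projection onto the ball of radius \<open>R\<close>.\<close>

definition truncate :: "real \<Rightarrow> 'a::real_normed_vector \<Rightarrow> 'a" where
  "truncate R v = (R / max R (norm v)) *\<^sub>R v"

lemma norm_truncate_le: "0 < R \<Longrightarrow> norm (truncate R v) \<le> R"
  by (auto simp: truncate_def max_def field_simps)

lemma norm_diff_truncate_le: "0 < R \<Longrightarrow> norm (v - truncate R v) \<le> norm v"
proof -
  assume R: "0 < R"
  define c where "c = R / max R (norm v)"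
  have "0 < max R (norm v)" using R by (simp add: less_max_iff_disj)
  then have c: "0 \<le> c" "c \<le> 1" using R by (simp_all add: c_def)
  have "norm (v - truncate R v) = norm ((1 - c) *\<^sub>R v)"
    by (simp add: truncate_def c_def scaleR_diff_left)
  also have "\<dots> \<le> norm v" using c by (simp add: mult_left_le_one_le)
  finally show ?thesis .
qed

lemma truncate_eq: "0 < R \<Longrightarrow> norm v \<le> R \<Longrightarrow> truncate R v = v"
  by (simp add: truncate_def max_def)

lemma continuous_on_truncate: "0 < R \<Longrightarrow> continuous_on UNIV (truncate R)"
  unfolding truncate_def[abs_def] by (intro continuous_intros) (auto simp: max_def)

text \<open>Truncating at a large height costs little in the mean, and a bounded measurable function is
  an almost everywhere limit of equally bounded continuous functions.\<close>

lemma continuous_approximation_Lp: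
  fixes F :: "real \<Rightarrow> 'a::euclidean_space"
  assumes p: "0 < p" and F: "F \<in> Lp_on p a b" and e: "0 < e"
  obtains H B where "continuous_on UNIV H" "\<And>s. norm (H s) \<le> B"
    "Lp_int p a b (\<lambda>s. F s - H s) < e"
proof -
  note Fm = Lp_on_measurable[OF F]
  have trunc_m: "(\<lambda>s. truncate R (f s)) \<in> borel_measurable borel"
    if "0 < R" "f \<in> borel_measurable borel" for R and f :: "real \<Rightarrow> 'a"
    using measurable_compose[OF that(2) borel_measurable_continuous_onI[OF continuous_on_truncate[OF that(1)]]] .
  define e' where "e' = e / (2 * 3 powr p)"
  have e': "0 < e'" using e by (simp add: e'_def)
  have "(\<lambda>n. Lp_int p a b (\<lambda>s. F s - truncate (real (Suc n)) (F s))) \<longlonglongrightarrow> 0"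
  proof (rule Lp_int_tendsto_zero[OF p _ Lp_on_integrable[OF F]])
    show "(\<lambda>s. F s - truncate (real (Suc n)) (F s)) \<in> borel_measurable borel" for n
      by (intro borel_measurable_diff Fm trunc_m) auto
    show "norm (F s - truncate (real (Suc n)) (F s)) powr p \<le> norm (F s) powr p" for n s
      using p by (intro powr_mono2 norm_diff_truncate_le) auto
    have "(\<lambda>n. F s - truncate (real (Suc n)) (F s)) \<longlonglongrightarrow> 0" for s
    proof (rule tendsto_eventually)
      obtain N where N: "norm (F s) \<le> real N" using real_arch_simple by blast
      show "\<forall>\<^sub>F n in sequentially. F s - truncate (real (Suc n)) (F s) = 0"
        using eventually_ge_at_top[of N] by eventually_elim (use N in \<open>auto simp: truncate_eq\<close>)
    qed
    then show "AE s in lebesgue. s \<in> {a..b} \<longrightarrow> (\<lambda>n. F s - truncate (real (Suc n)) (F s)) \<longlonglongrightarrow> 0"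
      by auto
  qed
  from order_tendstoD(2)[OF this e'] obtain n0 where
    n0: "Lp_int p a b (\<lambda>s. F s - truncate (real (Suc n0)) (F s)) < e'"
    by (meson eventually_sequentially order_refl)
  define R where "R = real (Suc n0)"
  have R: "0 < R" by (simp add: R_def)
  have "F measurable_on UNIV"
    using borel_imp_lebesgue_measurable[OF Fm] by (intro lebesgue_measurable_imp_measurable_on) auto
  then obtain N g where N: "negligible N" and g: "\<And>n. continuous_on UNIV (g n)"
    and lim: "\<And>s. s \<notin> N \<Longrightarrow> (\<lambda>n. g n s) \<longlonglongrightarrow> F s"
    unfolding measurable_on_def by auto
  have tg: "continuous_on UNIV (\<lambda>s. truncate R (g n s))" for n
    using continuous_on_compose2[OF continuous_on_truncate[OF R] g] by simp
  have "(\<lambda>n. Lp_int p a b (\<lambda>s. truncate R (F s) - truncate R (g n s))) \<longlonglongrightarrow> 0"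
  proof (rule Lp_int_tendsto_zero[OF p _ set_integrable_const_interval[of a b "(2 * R) powr p"]])
    show "(\<lambda>s. truncate R (F s) - truncate R (g n s)) \<in> borel_measurable borel" for n
      by (intro borel_measurable_diff trunc_m[OF R Fm] borel_measurable_continuous_onI tg)
    show "norm (truncate R (F s) - truncate R (g n s)) powr p \<le> (2 * R) powr p" for n s
      using p norm_triangle_ineq4[of "truncate R (F s)" "truncate R (g n s)"]
        norm_truncate_le[OF R, of "F s"] norm_truncate_le[OF R, of "g n s"]
      by (intro powr_mono2) auto
    have "AE s in lebesgue. s \<notin> N"
      using N by (intro AE_not_in) (simp add: negligible_iff_null_sets)
    then show "AE s in lebesgue. s \<in> {a..b} \<longrightarrow>
        (\<lambda>n. truncate R (F s) - truncate R (g n s)) \<longlonglongrightarrow> 0"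
    proof eventually_elim
      case (elim s)
      have "(\<lambda>n. truncate R (g n s)) \<longlonglongrightarrow> truncate R (F s)"
        using continuous_on_tendsto_compose[OF continuous_on_truncate[OF R] lim[OF elim]] by simp
      then show ?case using tendsto_diff[OF tendsto_const[of "truncate R (F s)"]] by fastforce
    qed
  qed
  from order_tendstoD(2)[OF this e'] obtain k where
    k: "Lp_int p a b (\<lambda>s. truncate R (F s) - truncate R (g k s)) < e'"
    by (meson eventually_sequentially order_refl)
  define H where "H s = truncate R (g k s)" for s
  have Hb: "norm (H s) \<le> R" for s using norm_truncate_le[OF R] by (simp add: H_def)
  have Hm: "H \<in> borel_measurable borel"
    using borel_measurable_continuous_onI[OF tg] by (simp add: H_def[abs_def])
  have HL: "H \<in> Lp_on p a b" and TL: "(\<lambda>s. truncate R (F s)) \<in> Lp_on p a b"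
    using p Hb norm_truncate_le[OF R] Hm trunc_m[OF R Fm] by (auto intro!: Lp_on_bounded[where B = R])
  have zL: "(\<lambda>_. 0::'a) \<in> Lp_on p a b" using p by (intro Lp_on_bounded[where B = 0]) auto
  have "Lp_int p a b (\<lambda>s. F s - H s) =
      Lp_int p a b (\<lambda>s. (F s - truncate R (F s)) + (truncate R (F s) - H s) + 0)" by simp
  also have "\<dots> \<le> 3 powr p * (Lp_int p a b (\<lambda>s. F s - truncate R (F s)) +
      Lp_int p a b (\<lambda>s. truncate R (F s) - H s) + Lp_int p a b (\<lambda>_. 0::'a))"
    using p by (intro Lp_int_add3_le Lp_on_diff F HL TL zL) auto
  also have "\<dots> < 3 powr p * (e' + e')"
    using n0 k by (simp add: R_def H_def)
  also have "\<dots> = e" by (simp add: e'_def)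
  finally have "Lp_int p a b (\<lambda>s. F s - H s) < e" .
  then show thesis using that[of H R] tg[of k] Hb by (simp add: H_def[abs_def])
qed

text \<open>The margin \<open>1\<close> around \<open>{a..b}\<close> leaves room for small translates. For a bounded continuous
  function the claim is dominated convergence; in general such an approximant \<open>H\<close> enters through
  \<open>F (s + t) - F s = (F - H) (s + t) + (H (s + t) - H s) + (H - F) s\<close>.\<close>

lemma Lp_translation_continuous:
  fixes F :: "real \<Rightarrow> 'a::euclidean_space"
  assumes p: "0 < p" and F: "F \<in> Lp_on p (a - 1) (b + 1)"
    and \<tau>: "\<tau> \<longlonglongrightarrow> 0"
  shows "(\<lambda>n. Lp_int p a b (\<lambda>s. F (s + \<tau> n) - F s)) \<longlonglongrightarrow> 0"
proof (rule order_tendstoI)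
  fix e :: real assume "e < 0"
  then show "\<forall>\<^sub>F n in sequentially. e < Lp_int p a b (\<lambda>s. F (s + \<tau> n) - F s)"
    by (intro always_eventually allI less_le_trans[OF _ Lp_int_nonneg])
next
  fix e :: real assume e: "0 < e"
  define e' where "e' = e / (3 * 3 powr p)"
  have e': "0 < e'" using e by (simp add: e'_def)
  obtain H B where H: "continuous_on UNIV H" and HB: "\<And>s. norm (H s) \<le> B"
    and FH: "Lp_int p (a - 1) (b + 1) (\<lambda>s. F s - H s) < e'"
    using continuous_approximation_Lp[OF p F e'] by blast
  have Hm: "H \<in> borel_measurable borel" by (rule borel_measurable_continuous_onI[OF H])
  have HL: "H \<in> Lp_on p c d" for c d
    using p HB Hm by (intro Lp_on_bounded[where B = B]) auto
  have "(\<lambda>n. Lp_int p a b (\<lambda>s. H (s + \<tau> n) - H s)) \<longlonglongrightarrow> 0"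
  proof (rule Lp_int_tendsto_zero[OF p _ set_integrable_const_interval[of a b "(2 * B) powr p"]])
    show "(\<lambda>s. H (s + \<tau> n) - H s) \<in> borel_measurable borel" for n
      using Hm by measurable
    show "norm (H (s + \<tau> n) - H s) powr p \<le> (2 * B) powr p" for n s
      using p norm_triangle_ineq4[of "H (s + \<tau> n)" "H s"] HB[of "s + \<tau> n"] HB[of s]
      by (intro powr_mono2) auto
    have "(\<lambda>n. H (s + \<tau> n) - H s) \<longlonglongrightarrow> 0" for s
    proof -
      have "(\<lambda>n. s + \<tau> n) \<longlonglongrightarrow> s" using tendsto_add[OF tendsto_const \<tau>, of s] by simp
      from continuous_on_tendsto_compose[OF H this] have "(\<lambda>n. H (s + \<tau> n)) \<longlonglongrightarrow> H s" by simp
      then show ?thesis by (simp add: LIM_zero)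
    qed
    then show "AE s in lebesgue. s \<in> {a..b} \<longrightarrow> (\<lambda>n. H (s + \<tau> n) - H s) \<longlonglongrightarrow> 0" by auto
  qed
  from order_tendstoD(2)[OF this e']
  have ev: "\<forall>\<^sub>F n in sequentially. Lp_int p a b (\<lambda>s. H (s + \<tau> n) - H s) < e'" .
  have ev1: "\<forall>\<^sub>F n in sequentially. \<bar>\<tau> n\<bar> < 1"
    using tendstoD[OF \<tau>, of 1] by simp
  have D: "(\<lambda>s. F s - H s) \<in> Lp_on p (a - 1) (b + 1)"
    using p by (intro Lp_on_diff F HL) auto
  show "\<forall>\<^sub>F n in sequentially. Lp_int p a b (\<lambda>s. F (s + \<tau> n) - F s) < e"
    using ev ev1
  proof eventually_elim
    case (elim n)
    have sub: "{a + \<tau> n..b + \<tau> n} \<subseteq> {a - 1..b + 1}" "{a..b} \<subseteq> {a - 1..b + 1}"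
      using elim(2) by auto
    have L1: "(\<lambda>s. F (s + \<tau> n) - H (s + \<tau> n)) \<in> Lp_on p a b"
      using Lp_on_translate[OF Lp_on_subset[OF D sub(1)]] .
    have L2: "(\<lambda>s. H (s + \<tau> n) - H s) \<in> Lp_on p a b"
      using p by (intro Lp_on_diff Lp_on_translate HL) auto
    have L3: "(\<lambda>s. H s - F s) \<in> Lp_on p a b"
      using p by (intro Lp_on_diff HL Lp_on_subset[OF F sub(2)]) auto
    have "Lp_int p a b (\<lambda>s. F (s + \<tau> n) - H (s + \<tau> n)) =
        Lp_int p (a + \<tau> n) (b + \<tau> n) (\<lambda>s. F s - H s)"
      by (rule Lp_int_translate[of "\<lambda>s. F s - H s"]) (rule Lp_on_measurable[OF D])
    also have "\<dots> < e'" using Lp_int_mono_set[OF D sub(1)] FH by simp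
    finally have 1: "Lp_int p a b (\<lambda>s. F (s + \<tau> n) - H (s + \<tau> n)) < e'" .
    have 3: "Lp_int p a b (\<lambda>s. H s - F s) < e'"
      using Lp_int_mono_set[OF D sub(2)] FH by (simp add: norm_minus_commute)
    have "Lp_int p a b (\<lambda>s. F (s + \<tau> n) - F s) =
        Lp_int p a b (\<lambda>s. (F (s + \<tau> n) - H (s + \<tau> n)) + (H (s + \<tau> n) - H s) + (H s - F s))"
      by simp
    also have "\<dots> \<le> 3 powr p * (Lp_int p a b (\<lambda>s. F (s + \<tau> n) - H (s + \<tau> n)) +
        Lp_int p a b (\<lambda>s. H (s + \<tau> n) - H s) + Lp_int p a b (\<lambda>s. H s - F s))"
      using p by (intro Lp_int_add3_le L1 L2 L3) auto
    also have "\<dots> < 3 powr p * (e' + e' + e')"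
      using 1 3 elim(1) by (intro mult_strict_left_mono add_strict_mono) auto
    also have "\<dots> = e" by (simp add: e'_def)
    finally show ?case .
  qed
qed

section \<open>Superposition along curves\<close>

text \<open>The functions that satisfy the first two conditions in the definition of
  \<^const>\<open>Theta_C\<close>. These two already make the seminorms finite, so everything about seminorms
  except continuity in time is available for them.\<close>

definition Lp_dominated :: "real \<Rightarrow> (real \<times> (real^'n) \<Rightarrow> real^'m) set" where
  "Lp_dominated p = {f. f \<in> borel_measurable borel \<and>
     (\<forall>K. compact K \<longrightarrow>
        (\<exists>m\<in>Lp_loc p. AE t in lebesgue. \<forall>x\<in>K. norm (f (t, x)) \<le> m t))}"

lemma time_translate_apply [simp]: "time_translate t f (s, x) = f (s + t, x)"
  by (simp add: time_translate_def)

lemma time_translate_0 [simp]: "time_translate 0 f = f"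
  by (auto simp: time_translate_def)

lemma time_translate_time_translate:
  "time_translate t (time_translate s f) = time_translate (t + s) f"
  by (auto simp: time_translate_def add.assoc)

lemma time_translate_measurable:
  fixes f :: "real \<times> (real^'n) \<Rightarrow> real^'m"
  assumes "f \<in> borel_measurable borel"
  shows "time_translate t f \<in> borel_measurable borel"
proof -
  have "(\<lambda>z :: real \<times> (real^'n). (fst z + t, snd z)) \<in> borel_measurable borel"
    by (intro borel_measurable_continuous_onI continuous_intros)
  from measurable_compose[OF this assms] show ?thesis
    by (simp add: time_translate_def case_prod_unfold)
qed

lemma Lp_loc_translate:
  assumes "m \<in> Lp_loc p"
  shows "(\<lambda>s. m (s + t)) \<in> Lp_loc p"
  using assms set_borel_measurable_translate[of _ t _ m]
    set_integrable_translate[of _ t _ "\<lambda>s. \<bar>m s\<bar> powr p"]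
  by (auto simp: Lp_loc_def)

lemma Lp_loc_add:
  assumes "0 \<le> p" "m \<in> Lp_loc p" "k \<in> Lp_loc p"
  shows "(\<lambda>s. m s + k s) \<in> Lp_loc p"
proof -
  have "set_borel_measurable lebesgue {a..b} (\<lambda>s. m s + k s) \<and>
      set_integrable lebesgue {a..b} (\<lambda>t. \<bar>m t + k t\<bar> powr p)" for a b
  proof -
    define M where "M s = indicator {a..b} s *\<^sub>R m s" for s
    define K where "K s = indicator {a..b} s *\<^sub>R k s" for s
    have meas: "M \<in> borel_measurable lebesgue" "K \<in> borel_measurable lebesgue"
      using assms(2,3) by (simp_all add: Lp_loc_def set_borel_measurable_def M_def[abs_def] K_def[abs_def])
    have sum: "M s + K s = indicator {a..b} s *\<^sub>R (m s + k s)" for s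
      by (simp add: M_def K_def distrib_left)
    have 1: "set_borel_measurable lebesgue {a..b} (\<lambda>s. m s + k s)"
      using borel_measurable_add[OF meas] unfolding set_borel_measurable_def sum .
    have "set_integrable lebesgue {a..b} (\<lambda>t. \<bar>m t + k t\<bar> powr p)"
    proof (rule set_integrable_bound)
      show "set_integrable lebesgue {a..b} (\<lambda>t. 3 powr p * (\<bar>m t\<bar> powr p + \<bar>k t\<bar> powr p))"
        using assms(2,3) by (intro set_integrable_mult_right set_integral_add) (auto simp: Lp_loc_def)
      have "set_borel_measurable lebesgue {a..b} (\<lambda>s. norm (M s + K s) powr p)"
        by (rule powr_norm_set_borel_measurable[OF borel_measurable_add[OF meas]])
      moreover have "(\<lambda>s. indicator {a..b} s *\<^sub>R norm (M s + K s) powr p) =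
          (\<lambda>s. indicator {a..b} s *\<^sub>R \<bar>m s + k s\<bar> powr p)"
        unfolding sum by (auto simp: fun_eq_iff indicator_def)
      ultimately show "set_borel_measurable lebesgue {a..b} (\<lambda>t. \<bar>m t + k t\<bar> powr p)"
        unfolding set_borel_measurable_def by (simp only:)
      show "AE t in lebesgue. t \<in> {a..b} \<longrightarrow> norm (\<bar>m t + k t\<bar> powr p) \<le>
          norm (3 powr p * (\<bar>m t\<bar> powr p + \<bar>k t\<bar> powr p))"
        using norm_add3_powr_le[OF assms(1), of "m _" "k _" 0] by (intro AE_I2) auto
    qed
    with 1 show ?thesis by blast
  qed
  then show ?thesis by (simp add: Lp_loc_def)
qed

lemma Lp_dominated_add:
  fixes f g :: "real \<times> (real^'n) \<Rightarrow> real^'m"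
  assumes "0 \<le> p" and f: "f \<in> Lp_dominated p" and g: "g \<in> Lp_dominated p"
  shows "(\<lambda>z. f z + g z) \<in> Lp_dominated p"
  unfolding Lp_dominated_def
proof (intro CollectI conjI allI impI)
  show "(\<lambda>z. f z + g z) \<in> borel_measurable borel"
    using f g by (auto simp: Lp_dominated_def)
  fix K :: "(real^'n) set" assume K: "compact K"
  obtain m k where m: "m \<in> Lp_loc p" "AE t in lebesgue. \<forall>x\<in>K. norm (f (t, x)) \<le> m t"
    and k: "k \<in> Lp_loc p" "AE t in lebesgue. \<forall>x\<in>K. norm (g (t, x)) \<le> k t"
    using f g K by (fastforce simp: Lp_dominated_def)
  have "AE t in lebesgue. \<forall>x\<in>K. norm (f (t, x) + g (t, x)) \<le> m t + k t"
    using m(2) k(2) by eventually_elim (use norm_triangle_mono in blast)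
  then show "\<exists>m\<in>Lp_loc p. AE t in lebesgue. \<forall>x\<in>K. norm (f (t, x) + g (t, x)) \<le> m t"
    by (rule bexI[OF _ Lp_loc_add[OF assms(1) m(1) k(1)]])
qed

lemma Lp_dominated_diff:
  fixes f g :: "real \<times> (real^'n) \<Rightarrow> real^'m"
  assumes "0 \<le> p" "f \<in> Lp_dominated p" "g \<in> Lp_dominated p"
  shows "(\<lambda>z. f z - g z) \<in> Lp_dominated p"
proof -
  have "(\<lambda>z. - g z) \<in> Lp_dominated p" using assms(3) by (auto simp: Lp_dominated_def)
  from Lp_dominated_add[OF assms(1,2) this] show ?thesis by simp
qed

lemma Lp_dominated_translate:
  fixes f :: "real \<times> (real^'n) \<Rightarrow> real^'m"
  assumes f: "f \<in> Lp_dominated p"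
  shows "time_translate t f \<in> Lp_dominated p"
  unfolding Lp_dominated_def
proof (intro CollectI conjI allI impI)
  show "time_translate t f \<in> borel_measurable borel"
    using f by (intro time_translate_measurable) (simp add: Lp_dominated_def)
  fix K :: "(real^'n) set" assume "compact K"
  then obtain m where m: "m \<in> Lp_loc p" "AE t in lebesgue. \<forall>x\<in>K. norm (f (t, x)) \<le> m t"
    using f by (fastforce simp: Lp_dominated_def)
  show "\<exists>m\<in>Lp_loc p. AE s in lebesgue. \<forall>x\<in>K. norm (time_translate t f (s, x)) \<le> m s"
  proof (rule bexI[OF _ Lp_loc_translate[OF m(1), of t]])
    show "AE s in lebesgue. \<forall>x\<in>K. norm (time_translate t f (s, x)) \<le> m (s + t)"
      using AE_lebesgue_translate[OF m(2), of t] by simp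
  qed
qed

text \<open>One bound serves all curves in a ball, since the dominating function depends only on the
  ball; hence the suprema that define the seminorms are finite.\<close>

lemma superposition_Lp_bound:
  fixes f :: "real \<times> (real^'n) \<Rightarrow> real^'m"
  assumes p: "0 \<le> p" and f: "f \<in> Lp_dominated p"
  obtains C where "\<And>y. continuous_on UNIV y \<Longrightarrow> (\<And>s. s \<in> {a..b} \<Longrightarrow> norm (y s) \<le> r) \<Longrightarrow>
    (\<lambda>s. f (s, y s)) \<in> Lp_on p a b \<and> Lp_int p a b (\<lambda>s. f (s, y s)) \<le> C"
proof -
  obtain m where m: "m \<in> Lp_loc p"
    "AE t in lebesgue. \<forall>x\<in>cball 0 r. norm (f (t, x)) \<le> m t"
    using f compact_cball[of "0 :: real^'n" r] unfolding Lp_dominated_def by blast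
  have mi: "set_integrable lebesgue {a..b} (\<lambda>s. \<bar>m s\<bar> powr p)"
    using m(1) by (simp add: Lp_loc_def)
  have "(\<lambda>s. f (s, y s)) \<in> Lp_on p a b \<and>
      Lp_int p a b (\<lambda>s. f (s, y s)) \<le> (LINT s:{a..b}|lebesgue. \<bar>m s\<bar> powr p)"
    if y: "continuous_on UNIV y" "\<And>s. s \<in> {a..b} \<Longrightarrow> norm (y s) \<le> r" for y
  proof -
    have "(\<lambda>s. (s, y s)) \<in> borel_measurable borel"
      by (intro borel_measurable_continuous_onI continuous_intros y)
    then have meas: "(\<lambda>s. f (s, y s)) \<in> borel_measurable borel"
      by (rule measurable_compose) (use f in \<open>simp add: Lp_dominated_def\<close>)
    have le: "AE s in lebesgue. s \<in> {a..b} \<longrightarrow> norm (f (s, y s)) powr p \<le> \<bar>m s\<bar> powr p"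
      using m(2)
    proof eventually_elim
      case (elim s)
      show ?case
      proof
        assume "s \<in> {a..b}"
        then have "norm (f (s, y s)) \<le> m s" using elim y(2) by auto
        then show "norm (f (s, y s)) powr p \<le> \<bar>m s\<bar> powr p"
          using p by (intro powr_mono2) auto
      qed
    qed
    have L: "(\<lambda>s. f (s, y s)) \<in> Lp_on p a b"
      by (rule Lp_on_dominated[OF meas mi le])
    then show ?thesis
      using set_integral_mono_AE[OF Lp_on_integrable[OF L] mi] le by auto
  qed
  then show thesis using that by blast
qed

text \<open>The curve moves with the interval \<open>{a..b}\<close> to \<open>{a + t..b + t}\<close> and is continued by its
  boundary values. The continuation keeps the modulus of continuity, because clamping is
  1-Lipschitz and moduli are monotone; this makes curves on translated intervals, whose end
  points are irrational in general, accessible from rational ones.\<close>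

definition shifted_curve :: "real \<Rightarrow> real \<Rightarrow> real \<Rightarrow> (real \<Rightarrow> 'a) \<Rightarrow> real \<Rightarrow> 'a" where
  "shifted_curve a b t x u = x (max a (min b (u - t)))"

lemma clamp_mem: "a \<le> b \<Longrightarrow> max a (min b u) \<in> {a..b::real}"
  by auto

lemma shifted_curve_eq: "s \<in> {a..b} \<Longrightarrow> shifted_curve a b t x (s + t) = x s"
  by (simp add: shifted_curve_def)

lemma continuous_shifted_curve:
  assumes "a \<le> b" "continuous_on {a..b} x"
  shows "continuous_on UNIV (shifted_curve a b t x)"
  unfolding shifted_curve_def[abs_def]
  by (rule continuous_on_compose2[OF assms(2)]) (auto intro!: continuous_intros simp: assms(1))

lemma rational_intervalI: "a \<in> \<rat> \<Longrightarrow> b \<in> \<rat> \<Longrightarrow> a \<le> b \<Longrightarrow> {a..b} \<in> rational_intervals"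
  by (auto simp: rational_intervals_def)

lemma rational_interval_superset:
  obtains c d :: real where "{c..d} \<in> rational_intervals" "c \<le> l" "r \<le> d" "c \<le> d"
proof (rule that)
  show "{of_int \<lfloor>min l r\<rfloor>..of_int \<lceil>max l r\<rceil> :: real} \<in> rational_intervals"
    by (rule rational_intervalI) (auto, linarith)
qed linarith+

lemma modulus_classD:
  assumes "x \<in> modulus_class \<theta> I j"
  shows "continuous_on I x" "\<And>s. s \<in> I \<Longrightarrow> norm (x s) \<le> real j"
    "\<And>s t. s \<in> I \<Longrightarrow> t \<in> I \<Longrightarrow> norm (x s - x t) \<le> \<theta> I j \<bar>s - t\<bar>"
  using assms by (auto simp: modulus_class_def)

lemma shifted_curve_modulus_class:
  assumes \<theta>: "suitable_moduli \<theta>" and j: "1 \<le> j"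
    and I: "{a..b} \<in> rational_intervals" "a \<le> b" and J: "J \<in> rational_intervals" "{a..b} \<subseteq> J"
    and x: "x \<in> modulus_class \<theta> {a..b} j"
  shows "shifted_curve a b t x \<in> modulus_class \<theta> J j"
proof -
  let ?y = "shifted_curve a b t x"
  note xD = modulus_classD[OF x]
  have "continuous_on J ?y"
    using continuous_on_subset[OF continuous_shifted_curve[OF I(2) xD(1)]] by auto
  moreover have "norm (?y u) \<le> real j" for u
    using xD(2)[OF clamp_mem[OF I(2)]] by (simp add: shifted_curve_def)
  moreover have "norm (?y u - ?y v) \<le> \<theta> J j \<bar>u - v\<bar>" for u v
  proof -
    define u' v' where "u' = max a (min b (u - t))" and "v' = max a (min b (v - t))"
    have mem: "u' \<in> {a..b}" "v' \<in> {a..b}"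
      using clamp_mem[OF I(2)] by (auto simp: u'_def v'_def)
    have "norm (?y u - ?y v) \<le> \<theta> {a..b} j \<bar>u' - v'\<bar>"
      using xD(3)[OF mem] by (simp add: shifted_curve_def u'_def v'_def)
    also have "\<dots> \<le> \<theta> {a..b} j \<bar>u - v\<bar>"
    proof (rule mono_onD[of "{0..}" "\<theta> {a..b} j"])
      show "mono_on {0..} (\<theta> {a..b} j)" using \<theta> I j by (auto simp: suitable_moduli_def)
      show "\<bar>u' - v'\<bar> \<le> \<bar>u - v\<bar>" by (auto simp: u'_def v'_def)
    qed auto
    also have "\<dots> \<le> \<theta> J j \<bar>u - v\<bar>"
      using \<theta> I j J unfolding suitable_moduli_def by auto
    finally show ?thesis .
  qed
  ultimately show ?thesis by (auto simp: modulus_class_def)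
qed

lemma uniform_limit_shifted_curve:
  fixes xs :: "nat \<Rightarrow> real \<Rightarrow> 'a::real_normed_vector"
  assumes ab: "a \<le> b" and x: "continuous_on {a..b} x"
    and lim: "uniform_limit {a..b} xs x sequentially" and \<tau>: "\<tau> \<longlonglongrightarrow> t"
  shows "uniform_limit J (\<lambda>n. shifted_curve a b (\<tau> n) (xs n)) (shifted_curve a b t x) sequentially"
  unfolding uniform_limit_iff
proof (intro allI impI)
  fix e :: real assume e: "0 < e"
  have "uniformly_continuous_on {a..b} x" by (rule compact_uniformly_continuous[OF x]) simp
  then obtain d where d: "0 < d"
    "\<And>s s'. s \<in> {a..b} \<Longrightarrow> s' \<in> {a..b} \<Longrightarrow> dist s' s < d \<Longrightarrow> dist (x s') (x s) < e / 2"
    unfolding uniformly_continuous_on_def using e by (meson half_gt_zero)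
  have "\<forall>\<^sub>F n in sequentially. dist (\<tau> n) t < d"
    using tendstoD[OF \<tau> d(1)] .
  moreover have "\<forall>\<^sub>F n in sequentially. \<forall>s\<in>{a..b}. dist (xs n s) (x s) < e / 2"
    using lim e unfolding uniform_limit_iff by (meson half_gt_zero)
  ultimately show "\<forall>\<^sub>F n in sequentially. \<forall>u\<in>J.
      dist (shifted_curve a b (\<tau> n) (xs n) u) (shifted_curve a b t x u) < e"
  proof eventually_elim
    case (elim n)
    show ?case
    proof
      fix u
      define v w where "v = max a (min b (u - \<tau> n))" and "w = max a (min b (u - t))"
      have vw: "v \<in> {a..b}" "w \<in> {a..b}" using clamp_mem[OF ab] by (auto simp: v_def w_def)
      have "dist v w \<le> dist (\<tau> n) t" by (auto simp: v_def w_def dist_real_def)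
      then have "dist (x v) (x w) < e / 2" using elim(1) by (intro d(2) vw) simp
      moreover have "dist (xs n v) (x v) < e / 2" using elim(2) vw(1) by blast
      ultimately have "dist (xs n v) (x w) < e"
        using dist_triangle[of "xs n v" "x w" "x v"] by linarith
      then show "dist (shifted_curve a b (\<tau> n) (xs n) u) (shifted_curve a b t x u) < e"
        by (simp add: shifted_curve_def v_def w_def)
    qed
  qed
qed

lemma Lp_int_shift_le:
  assumes "F \<in> Lp_on p c d" "{a + t..b + t} \<subseteq> {c..d}" "\<And>s. s \<in> {a..b} \<Longrightarrow> G s = F (s + t)"
  shows "Lp_int p a b G \<le> Lp_int p c d F"
proof -
  have "Lp_int p a b G = Lp_int p a b (\<lambda>s. F (s + t))"
    by (rule set_lebesgue_integral_cong) (auto simp: assms(3))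
  also have "\<dots> = Lp_int p (a + t) (b + t) F"
    by (rule Lp_int_translate[OF Lp_on_measurable[OF assms(1)]])
  also have "\<dots> \<le> Lp_int p c d F" by (rule Lp_int_mono_set[OF assms(1,2)])
  finally show ?thesis .
qed

lemma superposition_shifted_Lp_on:
  assumes "0 \<le> p" "f \<in> Lp_dominated p" "a \<le> b" "x \<in> modulus_class \<theta> {a..b} j"
  shows "(\<lambda>s. f (s, shifted_curve a b t x s)) \<in> Lp_on p c d"
proof -
  obtain C where C: "\<And>y. continuous_on UNIV y \<Longrightarrow> (\<And>s. s \<in> {c..d} \<Longrightarrow> norm (y s) \<le> real j) \<Longrightarrow>
    (\<lambda>s. f (s, y s)) \<in> Lp_on p c d \<and> Lp_int p c d (\<lambda>s. f (s, y s)) \<le> C"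
    using superposition_Lp_bound[OF assms(1,2)] by blast
  show ?thesis
    using C[OF continuous_shifted_curve[OF assms(3) modulus_classD(1)[OF assms(4)]], of t]
      modulus_classD(2)[OF assms(4) clamp_mem[OF assms(3)]]
    by (simp add: shifted_curve_def)
qed

text \<open>A curve in a modulus class is arbitrary outside its interval; its clamped version is
  continuous on the whole line, which makes superposition along it Borel measurable.\<close>

lemma Lp_int_clamp:
  "Lp_int p a b (\<lambda>s. f (s, x s)) = Lp_int p a b (\<lambda>s. f (s, shifted_curve a b 0 x s))"
  by (rule set_lebesgue_integral_cong) (auto simp: shifted_curve_def)

section \<open>The seminorms\<close>

lemma Theta_seminorm_upper:
  fixes f :: "real \<times> (real^'n) \<Rightarrow> real^'m"
  assumes p: "1 \<le> p" and f: "f \<in> Lp_dominated p" and ab: "a \<le> b"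
    and x: "x \<in> modulus_class \<theta> {a..b} j"
  shows "Lp_int p a b (\<lambda>s. f (s, x s)) powr (1 / p) \<le> Theta_seminorm p \<theta> {a..b} j f"
proof -
  let ?L = "\<lambda>x. Lp_int p a b (\<lambda>s. f (s, x s))"
  have p0: "0 \<le> p" using p by simp
  obtain C where C: "\<And>y. continuous_on UNIV y \<Longrightarrow> (\<And>s. s \<in> {a..b} \<Longrightarrow> norm (y s) \<le> real j) \<Longrightarrow>
    (\<lambda>s. f (s, y s)) \<in> Lp_on p a b \<and> Lp_int p a b (\<lambda>s. f (s, y s)) \<le> C"
    using superposition_Lp_bound[OF p0 f] by blast
  have "?L y powr (1 / p) \<le> C powr (1 / p)" if y: "y \<in> modulus_class \<theta> {a..b} j" for y
  proof -
    have "norm (shifted_curve a b 0 y s) \<le> real j" for s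
      using modulus_classD(2)[OF y clamp_mem[OF ab]] by (simp add: shifted_curve_def)
    then have "?L y \<le> C"
      unfolding Lp_int_clamp[where f = f and x = y]
      using C[OF continuous_shifted_curve[OF ab modulus_classD(1)[OF y]]] by blast
    then show ?thesis using p by (intro powr_mono2 Lp_int_nonneg) auto
  qed
  then have "bdd_above ((\<lambda>y. ?L y powr (1 / p)) ` modulus_class \<theta> {a..b} j)"
    by (auto simp: bdd_above_def)
  from cSUP_upper[OF x this] show ?thesis by (simp add: Theta_seminorm_def)
qed

lemma Lp_int_le_Theta_seminorm:
  fixes f :: "real \<times> (real^'n) \<Rightarrow> real^'m"
  assumes "1 \<le> p" "f \<in> Lp_dominated p" "a \<le> b" "x \<in> modulus_class \<theta> {a..b} j"
  shows "Lp_int p a b (\<lambda>s. f (s, x s)) \<le> Theta_seminorm p \<theta> {a..b} j f powr p"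
proof -
  have "(Lp_int p a b (\<lambda>s. f (s, x s)) powr (1 / p)) powr p \<le> Theta_seminorm p \<theta> {a..b} j f powr p"
    using assms(1) by (intro powr_mono2 Theta_seminorm_upper assms) auto
  then show ?thesis using assms(1) by (simp add: powr_powr Lp_int_nonneg)
qed

lemma Theta_seminorm_le:
  fixes f :: "real \<times> (real^'n) \<Rightarrow> real^'m"
  assumes "1 \<le> p" "suitable_moduli \<theta>" "{a..b} \<in> rational_intervals" "1 \<le> j" "0 \<le> A"
    and le: "\<And>x. x \<in> modulus_class \<theta> {a..b} j \<Longrightarrow> Lp_int p a b (\<lambda>s. f (s, x s)) \<le> A powr p"
  shows "Theta_seminorm p \<theta> {a..b} j f \<le> A"
  unfolding Theta_seminorm_def
proof (rule cSUP_least)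
  show "modulus_class \<theta> {a..b} j \<noteq> ({} :: (real \<Rightarrow> real^'n) set)"
    using zero_in_modulus_class[OF assms(2-4)] by blast
  fix x :: "real \<Rightarrow> real^'n" assume "x \<in> modulus_class \<theta> {a..b} j"
  then have "Lp_int p a b (\<lambda>s. f (s, x s)) powr (1 / p) \<le> (A powr p) powr (1 / p)"
    using assms(1) by (intro powr_mono2 le Lp_int_nonneg) auto
  then show "Lp_int p a b (\<lambda>s. f (s, x s)) powr (1 / p) \<le> A"
    using assms(1,5) by (simp add: powr_powr)
qed

lemma Theta_seminorm_nonneg:
  fixes f :: "real \<times> (real^'n) \<Rightarrow> real^'m"
  assumes "1 \<le> p" "suitable_moduli \<theta>" "{a..b} \<in> rational_intervals" "1 \<le> j"
    and f: "f \<in> Lp_dominated p" and ab: "a \<le> b"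
  shows "0 \<le> Theta_seminorm p \<theta> {a..b} j f"
  using order_trans[OF powr_ge_zero Theta_seminorm_upper[OF assms(1) f ab zero_in_modulus_class[OF assms(2-4)]]] .

lemma Theta_seminorm_triangle:
  fixes f g :: "real \<times> (real^'n) \<Rightarrow> real^'m"
  assumes p: "1 \<le> p" and \<theta>: "suitable_moduli \<theta>" "{a..b} \<in> rational_intervals" "1 \<le> j"
    and f: "f \<in> Lp_dominated p" and g: "g \<in> Lp_dominated p" and ab: "a \<le> b"
  shows "Theta_seminorm p \<theta> {a..b} j (\<lambda>z. f z + g z) \<le>
    Theta_seminorm p \<theta> {a..b} j f + Theta_seminorm p \<theta> {a..b} j g"
proof (rule field_le_epsilon)
  fix e :: real assume e: "0 < e"
  let ?S = "Theta_seminorm p \<theta> {a..b} j"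
  define A B where "A = ?S f + e / 2" and "B = ?S g + e / 2"
  have S0: "0 \<le> ?S f" "0 \<le> ?S g"
    using Theta_seminorm_nonneg[OF p \<theta>] f g ab by blast+
  then have AB: "0 < A" "0 < B" using e by (auto simp: A_def B_def)
  have p0: "0 \<le> p" using p by simp
  have "?S (\<lambda>z. f z + g z) \<le> A + B"
  proof (rule Theta_seminorm_le[OF p \<theta>])
    fix x :: "real \<Rightarrow> real^'n" assume x: "x \<in> modulus_class \<theta> {a..b} j"
    let ?y = "shifted_curve a b 0 x"
    have "Lp_int p a b (\<lambda>s. f (s, ?y s)) \<le> ?S f powr p"
      using Lp_int_le_Theta_seminorm[OF p f ab x] unfolding Lp_int_clamp[where f = f and x = x] .
    also have "\<dots> \<le> A powr p" using p0 S0 e by (intro powr_mono2) (auto simp: A_def)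
    finally have fA: "Lp_int p a b (\<lambda>s. f (s, ?y s)) \<le> A powr p" .
    have "Lp_int p a b (\<lambda>s. g (s, ?y s)) \<le> ?S g powr p"
      using Lp_int_le_Theta_seminorm[OF p g ab x] unfolding Lp_int_clamp[where f = g and x = x] .
    also have "\<dots> \<le> B powr p" using p0 S0 e by (intro powr_mono2) (auto simp: B_def)
    finally have gB: "Lp_int p a b (\<lambda>s. g (s, ?y s)) \<le> B powr p" .
    show "Lp_int p a b (\<lambda>s. f (s, x s) + g (s, x s)) \<le> (A + B) powr p"
      unfolding Lp_int_clamp[where f = "\<lambda>z. f z + g z" and x = x]
      by (intro Lp_int_Minkowski p AB fA gB superposition_shifted_Lp_on[OF p0 f ab x]
          superposition_shifted_Lp_on[OF p0 g ab x])
  qed (use AB in auto)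
  then show "?S (\<lambda>z. f z + g z) \<le> ?S f + ?S g + e" by (simp add: A_def B_def)
qed

text \<open>Superposition of a translate along a curve on \<open>I\<close> is superposition of the function itself along
  the shifted curve on \<open>I + t\<close>, and the shifted curve belongs to the modulus class of any rational
  interval that contains \<open>I\<close> and \<open>I + t\<close>.\<close>

lemma Theta_seminorm_translate_le:
  fixes f :: "real \<times> (real^'n) \<Rightarrow> real^'m"
  assumes p: "1 \<le> p" and \<theta>: "suitable_moduli \<theta>" and j: "1 \<le> j"
    and I: "{a..b} \<in> rational_intervals" "a \<le> b"
    and J: "{c..d} \<in> rational_intervals" "{a..b} \<subseteq> {c..d}" "{a + t..b + t} \<subseteq> {c..d}"
    and f: "f \<in> Lp_dominated p"
  shows "Theta_seminorm p \<theta> {a..b} j (time_translate t f) \<le> Theta_seminorm p \<theta> {c..d} j f"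
proof (rule Theta_seminorm_le[OF p \<theta> I(1) j])
  have cd: "c \<le> d" using I(2) J(2) by auto
  show "0 \<le> Theta_seminorm p \<theta> {c..d} j f"
    by (rule Theta_seminorm_nonneg[OF p \<theta> J(1) j f cd])
  fix x :: "real \<Rightarrow> real^'n" assume x: "x \<in> modulus_class \<theta> {a..b} j"
  have p0: "0 \<le> p" using p by simp
  let ?y = "shifted_curve a b t x"
  have "Lp_int p a b (\<lambda>s. time_translate t f (s, x s)) \<le> Lp_int p c d (\<lambda>u. f (u, ?y u))"
    by (rule Lp_int_shift_le[OF superposition_shifted_Lp_on[OF p0 f I(2) x] J(3)])
      (simp add: shifted_curve_eq)
  also have "\<dots> \<le> Theta_seminorm p \<theta> {c..d} j f powr p"
    by (rule Lp_int_le_Theta_seminorm[OF p f cd shifted_curve_modulus_class[OF \<theta> j I J(1,2) x]])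
  finally show "Lp_int p a b (\<lambda>s. time_translate t f (s, x s)) \<le> Theta_seminorm p \<theta> {c..d} j f powr p" .
qed

section \<open>Translation within the function space\<close>

lemma Theta_C_imp_Lp_dominated:
  fixes f :: "real \<times> (real^'n) \<Rightarrow> real^'m"
  assumes "f \<in> Theta_C p \<theta>"
  shows "f \<in> Lp_dominated p"
  using assms by (simp add: Theta_C_def Lp_dominated_def)

lemma Lp_int_squeeze:
  assumes "g \<longlonglongrightarrow> 0" "\<And>n. Lp_int p a b (F n) \<le> g n"
  shows "(\<lambda>n. Lp_int p a b (F n)) \<longlonglongrightarrow> 0"
  by (rule Lim_null_comparison[OF always_eventually assms(1)])
    (use assms(2) in \<open>simp add: abs_of_nonneg[OF Lp_int_nonneg]\<close>)

lemma Theta_C_superposition_tendsto: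
  fixes f :: "real \<times> (real^'n) \<Rightarrow> real^'m"
  assumes "f \<in> Theta_C p \<theta>" "{a..b} \<in> rational_intervals" "1 \<le> j"
    and "\<And>n. xs n \<in> modulus_class \<theta> {a..b} j" "x \<in> modulus_class \<theta> {a..b} j"
    and "uniform_limit {a..b} xs x sequentially"
  shows "(\<lambda>n. Lp_int p a b (\<lambda>s. f (s, xs n s) - f (s, x s))) \<longlonglongrightarrow> 0"
  using assms(1)[unfolded Theta_C_def, THEN CollectD, THEN conjunct2, THEN conjunct2, rule_format,
      OF assms(2,3,5), of xs] assms(4,6) by blast

text \<open>For the third condition on \<open>I\<close>, the curves are shifted to a rational interval that contains
  both \<open>I\<close> and \<open>I + t\<close>; uniform convergence is preserved, so the third condition applies there
  and bounds the integral over \<open>I\<close>. The interval has to contain \<open>I\<close> too, because moduli of different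
  intervals are comparable only under inclusion.\<close>

lemma Theta_C_translate:
  fixes f :: "real \<times> (real^'n) \<Rightarrow> real^'m"
  assumes p: "1 \<le> p" and \<theta>: "suitable_moduli \<theta>" and f: "f \<in> Theta_C p \<theta>"
  shows "time_translate t f \<in> Theta_C p \<theta>"
proof -
  have p0: "0 \<le> p" using p by simp
  note fd = Theta_C_imp_Lp_dominated[OF f]
  have T: "(\<lambda>n. LINT s:I|lebesgue. norm (time_translate t f (s, xs n s) - time_translate t f (s, x s)) powr p)
      \<longlonglongrightarrow> 0"
    if I: "I \<in> rational_intervals" and j: "1 \<le> j" and x: "x \<in> modulus_class \<theta> I j"
      and xs: "\<And>n. xs n \<in> modulus_class \<theta> I j" and lim: "uniform_limit I xs x sequentially"
    for I j xs x
  proof -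
    obtain a b where ab: "I = {a..b}" "a \<le> b" using I by (auto simp: rational_intervals_def)
    obtain c d where cd: "{c..d} \<in> rational_intervals" "c \<le> min a (a + t)" "max b (b + t) \<le> d" "c \<le> d"
      by (rule rational_interval_superset)
    have sub: "{a..b} \<subseteq> {c..d}" "{a + t..b + t} \<subseteq> {c..d}" using cd by auto
    let ?y = "shifted_curve a b t"
    note I' = I[unfolded ab(1)]
    have mem: "?y x \<in> modulus_class \<theta> {c..d} j" "?y (xs n) \<in> modulus_class \<theta> {c..d} j" for n
      using shifted_curve_modulus_class[OF \<theta> j I' ab(2) cd(1) sub(1)] x xs unfolding ab(1) by blast+
    have "(\<lambda>n. Lp_int p c d (\<lambda>u. f (u, ?y (xs n) u) - f (u, ?y x u))) \<longlonglongrightarrow> 0"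
    proof (rule Theta_C_superposition_tendsto[OF f cd(1) j])
      show "uniform_limit {c..d} (\<lambda>n. ?y (xs n)) (?y x) sequentially"
        using x lim unfolding ab(1)
        by (intro uniform_limit_shifted_curve tendsto_const ab modulus_classD(1))
    qed (fact mem)+
    moreover have "Lp_int p a b (\<lambda>s. time_translate t f (s, xs n s) - time_translate t f (s, x s)) \<le>
        Lp_int p c d (\<lambda>u. f (u, ?y (xs n) u) - f (u, ?y x u))" for n
    proof (rule Lp_int_shift_le[OF _ sub(2)])
      show "(\<lambda>u. f (u, ?y (xs n) u) - f (u, ?y x u)) \<in> Lp_on p c d"
        using x xs[of n] unfolding ab(1)
        by (intro Lp_on_diff p0 superposition_shifted_Lp_on[OF p0 fd ab(2)])
    qed (simp add: shifted_curve_eq)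
    ultimately show ?thesis
      unfolding ab(1) by (rule Lp_int_squeeze)
  qed
  show ?thesis
    unfolding Theta_C_def
  proof (intro CollectI conjI)
    show "time_translate t f \<in> borel_measurable borel"
      "\<forall>K. compact K \<longrightarrow>
        (\<exists>m\<in>Lp_loc p. AE s in lebesgue. \<forall>x\<in>K. norm (time_translate t f (s, x)) \<le> m s)"
      using Lp_dominated_translate[OF fd, of t] unfolding Lp_dominated_def by blast+
    show "\<forall>I\<in>rational_intervals. \<forall>j\<ge>1. \<forall>xs. \<forall>x\<in>modulus_class \<theta> I j.
        (\<forall>n. xs n \<in> modulus_class \<theta> I j) \<and> uniform_limit I xs x sequentially \<longrightarrow>
        (\<lambda>n. LINT s:I|lebesgue. norm (time_translate t f (s, xs n s) - time_translate t f (s, x s)) powr p)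
          \<longlonglongrightarrow> 0"
      using T by blast
  qed
qed

section \<open>Continuity in time\<close>

text \<open>By Arzela--Ascoli: the modulus is a common one, hence the curves are equicontinuous, and
  both the modulus and the bound survive pointwise limits.\<close>

lemma modulus_class_sequentially_compact:
  fixes xs :: "nat \<Rightarrow> real \<Rightarrow> real^'n"
  assumes \<theta>: "suitable_moduli \<theta>" and I: "{a..b} \<in> rational_intervals" and j: "1 \<le> j"
    and xs: "\<And>n. xs n \<in> modulus_class \<theta> {a..b} j"
  obtains x r where "x \<in> modulus_class \<theta> {a..b} j" "strict_mono (r :: nat \<Rightarrow> nat)"
    "uniform_limit {a..b} (\<lambda>n. xs (r n)) x sequentially"
proof -
  have cont: "continuous_on {0..} (\<theta> {a..b} j)" and zero: "\<theta> {a..b} j 0 = 0"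
    using \<theta> I j by (auto simp: suitable_moduli_def)
  have eq: "\<exists>d. 0 < d \<and> (\<forall>n s'. s' \<in> {a..b} \<and> norm (s - s') < d \<longrightarrow> norm (xs n s - xs n s') < e)"
    if s: "s \<in> {a..b}" and e: "0 < e" for s e
  proof -
    obtain d where d: "0 < d" "\<And>h. h \<in> {0..} \<Longrightarrow> dist h 0 < d \<Longrightarrow> dist (\<theta> {a..b} j h) (\<theta> {a..b} j 0) < e"
      using cont e unfolding continuous_on_iff by (metis atLeast_iff order_refl)
    have "norm (xs n s - xs n s') < e" if s': "s' \<in> {a..b}" "norm (s - s') < d" for n s'
      using modulus_classD(3)[OF xs s s'(1), of n] d(2)[of "\<bar>s - s'\<bar>"] s'(2) zero
      by (simp add: dist_real_def)
    then show ?thesis using d(1) by blast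
  qed
  have bd: "norm (xs n s) \<le> real j" if "s \<in> {a..b}" for n s
    by (rule modulus_classD(2)[OF xs that])
  obtain x r where x: "continuous_on {a..b} x" and r: "strict_mono (r :: nat \<Rightarrow> nat)"
    and lim: "\<And>e. 0 < e \<Longrightarrow> \<exists>N. \<forall>n s. n \<ge> N \<and> s \<in> {a..b} \<longrightarrow> norm (xs (r n) s - x s) < e"
    using Arzela_Ascoli[of "{a..b}" xs "real j"] bd eq compact_Icc by metis
  have ul: "uniform_limit {a..b} (\<lambda>n. xs (r n)) x sequentially"
    using lim by (fastforce simp: uniform_limit_iff eventually_sequentially dist_norm)
  have pt: "(\<lambda>n. xs (r n) s) \<longlonglongrightarrow> x s" if "s \<in> {a..b}" for s
    by (rule tendsto_uniform_limitI[OF ul that])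
  have "norm (x s) \<le> real j" if "s \<in> {a..b}" for s
    using tendsto_norm[OF pt[OF that]] bd[OF that] by (intro LIMSEQ_le_const2) auto
  moreover have "norm (x s - x t) \<le> \<theta> {a..b} j \<bar>s - t\<bar>" if "s \<in> {a..b}" "t \<in> {a..b}" for s t
    using tendsto_norm[OF tendsto_diff[OF pt[OF that(1)] pt[OF that(2)]]] modulus_classD(3)[OF xs that]
    by (intro LIMSEQ_le_const2) auto
  ultimately have "x \<in> modulus_class \<theta> {a..b} j" using x by (auto simp: modulus_class_def)
  then show thesis using that r ul by blast
qed

text \<open>Along convergent curves \<open>xs n \<longlonglongrightarrow> x\<close> and times \<open>\<tau> n \<longlonglongrightarrow> 0\<close> the difference
  \<open>f (s + \<tau> n, xs n s) - f (s, xs n s)\<close> is split by inserting the values of \<open>f\<close> along the limit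
  curve at both times. The two outer terms are governed by the third condition of
  \<^const>\<open>Theta_C\<close>, for the shifted curves on a larger interval and for the curves themselves;
  the middle one is a translation of the single function \<open>u \<mapsto> f (u, x u)\<close>.\<close>

lemma translate_superposition_tendsto:
  fixes f :: "real \<times> (real^'n) \<Rightarrow> real^'m"
  assumes p: "1 \<le> p" and \<theta>: "suitable_moduli \<theta>" and f: "f \<in> Theta_C p \<theta>"
    and I: "{a..b} \<in> rational_intervals" "a \<le> b" and j: "1 \<le> j"
    and xs: "\<And>n. xs n \<in> modulus_class \<theta> {a..b} j" and x: "x \<in> modulus_class \<theta> {a..b} j"
    and lim: "uniform_limit {a..b} xs x sequentially"
    and \<tau>: "\<tau> \<longlonglongrightarrow> 0" and \<tau>1: "\<And>n. \<bar>\<tau> n\<bar> \<le> 1"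
  shows "(\<lambda>n. Lp_int p a b (\<lambda>s. f (s + \<tau> n, xs n s) - f (s, xs n s))) \<longlonglongrightarrow> 0"
proof -
  have p0: "0 \<le> p" "0 < p" using p by simp_all
  note fd = Theta_C_imp_Lp_dominated[OF f]
  obtain c d where cd: "{c..d} \<in> rational_intervals" "c \<le> a - 1" "b + 1 \<le> d" "c \<le> d"
    by (rule rational_interval_superset)
  have sub: "{a..b} \<subseteq> {c..d}" "{a + \<tau> n..b + \<tau> n} \<subseteq> {c..d}"
    "{a + \<tau> n..b + \<tau> n} \<subseteq> {a - 1..b + 1}" for n
    using cd \<tau>1[of n] by auto
  define y where "y = shifted_curve a b 0 x"
  define ys where "ys n = shifted_curve a b (\<tau> n) (xs n)" for n
  define zs where "zs n = shifted_curve a b 0 (xs n)" for n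
  have supL: "(\<lambda>u. f (u, y u)) \<in> Lp_on p l r" "(\<lambda>u. f (u, ys n u)) \<in> Lp_on p l r"
    "(\<lambda>u. f (u, zs n u)) \<in> Lp_on p l r" for n l r
    unfolding y_def ys_def zs_def
    by (rule superposition_shifted_Lp_on[OF p0(1) fd I(2) x]
        superposition_shifted_Lp_on[OF p0(1) fd I(2) xs])+
  define D1 where "D1 n u = f (u, ys n u) - f (u, y u)" for n u
  define D2 where "D2 n s = f (s + \<tau> n, y (s + \<tau> n)) - f (s, y s)" for n s
  define D3 where "D3 n s = f (s, y s) - f (s, zs n s)" for n s
  have DL: "D1 n \<in> Lp_on p l r" "D2 n \<in> Lp_on p l r" "D3 n \<in> Lp_on p l r" for n l r
    unfolding D1_def[abs_def] D2_def[abs_def] D3_def[abs_def]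
    by (intro Lp_on_diff p0 supL Lp_on_translate[where F = "\<lambda>u. f (u, y u)"])+
  have "(\<lambda>n. Lp_int p c d (D1 n)) \<longlonglongrightarrow> 0"
    unfolding D1_def
  proof (rule Theta_C_superposition_tendsto[OF f cd(1) j])
    show "ys n \<in> modulus_class \<theta> {c..d} j" "y \<in> modulus_class \<theta> {c..d} j" for n
      unfolding ys_def y_def by (intro shifted_curve_modulus_class[OF \<theta> j I cd(1) sub(1)] xs x)+
    show "uniform_limit {c..d} ys y sequentially"
      unfolding ys_def[abs_def] y_def
      by (intro uniform_limit_shifted_curve I(2) modulus_classD(1)[OF x] lim \<tau>)
  qed
  moreover have "(\<lambda>n. Lp_int p a b (D2 n)) \<longlonglongrightarrow> 0"
    unfolding D2_def by (rule Lp_translation_continuous[OF p0(2) supL(1) \<tau>])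
  moreover have "(\<lambda>n. Lp_int p a b (D3 n)) \<longlonglongrightarrow> 0"
  proof -
    have "(\<lambda>n. Lp_int p a b (\<lambda>s. f (s, xs n s) - f (s, x s))) \<longlonglongrightarrow> 0"
      by (rule Theta_C_superposition_tendsto[OF f I(1) j xs x lim])
    moreover have "Lp_int p a b (\<lambda>s. f (s, xs n s) - f (s, x s)) = Lp_int p a b (D3 n)" for n
      by (rule set_lebesgue_integral_cong)
        (auto simp: D3_def y_def zs_def shifted_curve_def norm_minus_commute)
    ultimately show ?thesis by simp
  qed
  ultimately have "(\<lambda>n. 3 powr p * (Lp_int p c d (D1 n) + Lp_int p a b (D2 n) + Lp_int p a b (D3 n)))
      \<longlonglongrightarrow> 3 powr p * (0 + 0 + 0)"
    by (intro tendsto_intros)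
  then have bound: "(\<lambda>n. 3 powr p * (Lp_int p c d (D1 n) + Lp_int p a b (D2 n) + Lp_int p a b (D3 n)))
      \<longlonglongrightarrow> 0" by simp
  have "Lp_int p a b (\<lambda>s. f (s + \<tau> n, xs n s) - f (s, xs n s)) \<le>
      3 powr p * (Lp_int p c d (D1 n) + Lp_int p a b (D2 n) + Lp_int p a b (D3 n))" for n
  proof -
    have D1': "(\<lambda>s. D1 n (s + \<tau> n)) \<in> Lp_on p a b" by (rule Lp_on_translate[OF DL(1)])
    have "Lp_int p a b (\<lambda>s. f (s + \<tau> n, xs n s) - f (s, xs n s)) =
        Lp_int p a b (\<lambda>s. D1 n (s + \<tau> n) + D2 n s + D3 n s)"
    proof (rule set_lebesgue_integral_cong)
      have "f (s + \<tau> n, xs n s) - f (s, xs n s) = D1 n (s + \<tau> n) + D2 n s + D3 n s" if "s \<in> {a..b}" for s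
        using shifted_curve_eq[OF that, of "\<tau> n" "xs n"] shifted_curve_eq[OF that, of 0 "xs n"]
        by (simp add: D1_def D2_def D3_def ys_def zs_def)
      then show "\<forall>s. s \<in> {a..b} \<longrightarrow> norm (f (s + \<tau> n, xs n s) - f (s, xs n s)) powr p =
          norm (D1 n (s + \<tau> n) + D2 n s + D3 n s) powr p"
        by simp
    qed simp
    also have "\<dots> \<le> 3 powr p * (Lp_int p a b (\<lambda>s. D1 n (s + \<tau> n)) + Lp_int p a b (D2 n) + Lp_int p a b (D3 n))"
      by (rule Lp_int_add3_le[OF p0(1) D1' DL(2,3)])
    also have "Lp_int p a b (\<lambda>s. D1 n (s + \<tau> n)) \<le> Lp_int p c d (D1 n)"
      by (rule Lp_int_shift_le[OF DL(1) sub(2)]) simp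
    finally show ?thesis by simp
  qed
  with bound show ?thesis by (rule Lp_int_squeeze)
qed

text \<open>Uniformity over the curves comes from compactness: curves that violate the estimate for
  times tending to \<open>0\<close> would accumulate at some curve.\<close>

lemma Theta_seminorm_translate_small:
  fixes f :: "real \<times> (real^'n) \<Rightarrow> real^'m"
  assumes p: "1 \<le> p" and \<theta>: "suitable_moduli \<theta>" and f: "f \<in> Theta_C p \<theta>"
    and I: "{a..b} \<in> rational_intervals" "a \<le> b" and j: "1 \<le> j" and e: "0 < e"
  obtains \<delta> where "0 < \<delta>"
    "\<And>t. \<bar>t\<bar> < \<delta> \<Longrightarrow> Theta_seminorm p \<theta> {a..b} j (\<lambda>z. time_translate t f z - f z) \<le> e"
proof (rule ccontr)
  assume no: "\<not> thesis"
  note witness = that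
  have "\<exists>t x. \<bar>t\<bar> < \<delta> \<and> x \<in> modulus_class \<theta> {a..b} j \<and>
      e powr p < Lp_int p a b (\<lambda>s. f (s + t, x s) - f (s, x s))" if \<delta>: "0 < \<delta>" for \<delta>
  proof -
    have "\<exists>t. \<bar>t\<bar> < \<delta> \<and> \<not> Theta_seminorm p \<theta> {a..b} j (\<lambda>z. time_translate t f z - f z) \<le> e"
    proof (rule ccontr)
      assume "\<nexists>t. \<bar>t\<bar> < \<delta> \<and> \<not> Theta_seminorm p \<theta> {a..b} j (\<lambda>z. time_translate t f z - f z) \<le> e"
      then have "Theta_seminorm p \<theta> {a..b} j (\<lambda>z. time_translate t f z - f z) \<le> e" if "\<bar>t\<bar> < \<delta>" for t
        using that by blast
      with no show False using witness[OF \<delta>] by blast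
    qed
    then obtain t where t: "\<bar>t\<bar> < \<delta>"
      "\<not> Theta_seminorm p \<theta> {a..b} j (\<lambda>z. time_translate t f z - f z) \<le> e" by blast
    have "\<exists>x. x \<in> modulus_class \<theta> {a..b} j \<and> e powr p < Lp_int p a b (\<lambda>s. f (s + t, x s) - f (s, x s))"
    proof (rule ccontr)
      assume "\<nexists>x. x \<in> modulus_class \<theta> {a..b} j \<and>
        e powr p < Lp_int p a b (\<lambda>s. f (s + t, x s) - f (s, x s))"
      then have "Lp_int p a b (\<lambda>s. f (s + t, x s) - f (s, x s)) \<le> e powr p"
        if "x \<in> modulus_class \<theta> {a..b} j" for x using that by (meson not_le)
      then have "Theta_seminorm p \<theta> {a..b} j (\<lambda>z. time_translate t f z - f z) \<le> e"
        by (intro Theta_seminorm_le[OF p \<theta> I(1) j less_imp_le[OF e]]) simp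
      with t(2) show False by simp
    qed
    then show ?thesis using t(1) by blast
  qed
  then have "\<forall>n. \<exists>t x. \<bar>t\<bar> < inverse (real (Suc n)) \<and> x \<in> modulus_class \<theta> {a..b} j \<and>
      e powr p < Lp_int p a b (\<lambda>s. f (s + t, x s) - f (s, x s))"
    by (intro allI) simp
  from choice[OF this] obtain \<tau> where "\<forall>n. \<exists>x. \<bar>\<tau> n\<bar> < inverse (real (Suc n)) \<and>
      x \<in> modulus_class \<theta> {a..b} j \<and> e powr p < Lp_int p a b (\<lambda>s. f (s + \<tau> n, x s) - f (s, x s))" ..
  from choice[OF this] obtain xs where \<tau>xs: "\<forall>n. \<bar>\<tau> n\<bar> < inverse (real (Suc n)) \<and>
      xs n \<in> modulus_class \<theta> {a..b} j \<and>
      e powr p < Lp_int p a b (\<lambda>s. f (s + \<tau> n, xs n s) - f (s, xs n s))" ..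
  then have \<tau>: "\<And>n. \<bar>\<tau> n\<bar> < inverse (real (Suc n))"
    and xs: "\<And>n. xs n \<in> modulus_class \<theta> {a..b} j"
    and large: "\<And>n. e powr p < Lp_int p a b (\<lambda>s. f (s + \<tau> n, xs n s) - f (s, xs n s))"
    by blast+
  obtain x r where x: "x \<in> modulus_class \<theta> {a..b} j" and r: "strict_mono (r :: nat \<Rightarrow> nat)"
    and lim: "uniform_limit {a..b} (\<lambda>n. xs (r n)) x sequentially"
    by (rule modulus_class_sequentially_compact[OF \<theta> I(1) j xs])
  have \<tau>0: "\<tau> \<longlonglongrightarrow> 0"
    by (rule Lim_null_comparison[OF always_eventually LIMSEQ_inverse_real_of_nat])
      (use \<tau> in \<open>auto intro: less_imp_le\<close>)
  have \<tau>r: "(\<lambda>n. \<tau> (r n)) \<longlonglongrightarrow> 0"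
    using LIMSEQ_subseq_LIMSEQ[OF \<tau>0 r] by (simp add: o_def)
  have \<tau>1: "\<bar>\<tau> n\<bar> \<le> 1" for n
    using less_le_trans[OF \<tau>[of n], of 1] by (simp add: inverse_eq_divide)
  have "(\<lambda>n. Lp_int p a b (\<lambda>s. f (s + \<tau> (r n), xs (r n) s) - f (s, xs (r n) s))) \<longlonglongrightarrow> 0"
    by (rule translate_superposition_tendsto[OF p \<theta> f I j xs x lim \<tau>r \<tau>1])
  then have "e powr p \<le> 0"
    by (rule LIMSEQ_le_const) (use large in \<open>auto intro: less_imp_le\<close>)
  then show False using e by simp
qed

section \<open>The flow on the quotient\<close>

lemma Theta_rel_translate:
  fixes f g :: "real \<times> (real^'n) \<Rightarrow> real^'m"
  assumes p: "1 \<le> p" and \<theta>: "suitable_moduli \<theta>" and fg: "(f, g) \<in> Theta_rel p \<theta>"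
  shows "(time_translate t f, time_translate t g) \<in> Theta_rel p \<theta>"
proof -
  have C: "f \<in> Theta_C p \<theta>" "g \<in> Theta_C p \<theta>" and ae: "AE z in lebesgue. f z = g z"
    using fg by (simp_all add: Theta_rel_def)
  have shift: "time_translate t h z = h (z + (t, 0))" for h :: "real \<times> (real^'n) \<Rightarrow> real^'m" and z
    by (cases z) simp
  have "AE z in lebesgue. time_translate t f z = time_translate t g z"
    using AE_lebesgue_translate[OF ae, of "(t, 0)"] by (simp only: shift)
  then show ?thesis
    using C[THEN Theta_C_translate[OF p \<theta>, of _ t]] by (simp add: Theta_rel_def)
qed

lemma Theta_class_eq_iff:
  fixes f g :: "real \<times> (real^'n) \<Rightarrow> real^'m"
  assumes "f \<in> Theta_C p \<theta>" "g \<in> Theta_C p \<theta>"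
  shows "Theta_class p \<theta> f = Theta_class p \<theta> g \<longleftrightarrow> (f, g) \<in> Theta_rel p \<theta>"
  unfolding Theta_class_def using eq_equiv_class_iff[OF equiv_Theta_rel assms] .

lemma mem_Theta_class_iff: "g \<in> Theta_class p \<theta> f \<longleftrightarrow> (f, g) \<in> Theta_rel p \<theta>"
  by (simp add: Theta_class_def)

lemma mem_Theta_class_self: "f \<in> Theta_C p \<theta> \<Longrightarrow> f \<in> Theta_class p \<theta> f"
  by (simp add: mem_Theta_class_iff Theta_rel_def)

lemma Theta_class_in_quotient: "f \<in> Theta_C p \<theta> \<Longrightarrow> Theta_class p \<theta> f \<in> Theta_C p \<theta> // Theta_rel p \<theta>"
  unfolding Theta_class_def by (rule quotientI)

lemma Theta_quotientE:
  assumes "A \<in> Theta_C p \<theta> // Theta_rel p \<theta>"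
  obtains f where "f \<in> Theta_C p \<theta>" "A = Theta_class p \<theta> f"
  using assms unfolding Theta_class_def by (rule quotientE)

lemma translation_map_Theta_class:
  fixes f :: "real \<times> (real^'n) \<Rightarrow> real^'m"
  assumes p: "1 \<le> p" and \<theta>: "suitable_moduli \<theta>" and f: "f \<in> Theta_C p \<theta>"
  shows "translation_map p \<theta> (t, Theta_class p \<theta> f) = Theta_class p \<theta> (time_translate t f)"
proof -
  have "Theta_class p \<theta> (time_translate t g) = Theta_class p \<theta> (time_translate t f)"
    if "g \<in> Theta_class p \<theta> f" for g
  proof -
    have fg: "(f, g) \<in> Theta_rel p \<theta>" using that by (simp add: mem_Theta_class_iff)
    then have "g \<in> Theta_C p \<theta>" by (simp add: Theta_rel_def)
    then show ?thesis
      using Theta_rel_translate[OF p \<theta> fg, of t] Theta_class_eq_iff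
        Theta_C_translate[OF p \<theta> f, of t] Theta_C_translate[OF p \<theta>, of g t] by blast
  qed
  then have "(\<Union>g\<in>Theta_class p \<theta> f. Theta_class p \<theta> (time_translate t g)) =
      (\<Union>g\<in>Theta_class p \<theta> f. Theta_class p \<theta> (time_translate t f))"
    by (rule SUP_cong[OF refl])
  also have "\<dots> = Theta_class p \<theta> (time_translate t f)"
    using mem_Theta_class_self[OF f] by blast
  finally show ?thesis by (simp add: translation_map_def)
qed

definition Theta_ball ::
    "real \<Rightarrow> (real set \<Rightarrow> nat \<Rightarrow> real \<Rightarrow> real) \<Rightarrow> real set \<Rightarrow> nat \<Rightarrow> (real \<times> (real^'n) \<Rightarrow> real^'m) \<Rightarrow>
      real \<Rightarrow> (real \<times> (real^'n) \<Rightarrow> real^'m) set set" where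
  "Theta_ball p \<theta> I j f \<epsilon> =
    {A \<in> Theta_C p \<theta> // Theta_rel p \<theta>. \<exists>g\<in>A. Theta_seminorm p \<theta> I j (\<lambda>z. g z - f z) < \<epsilon>}"

lemma Theta_topology_eq:
  "Theta_topology p \<theta> = topology_generated_by
    {Theta_ball p \<theta> I j f \<epsilon> | f I j \<epsilon>. f \<in> Theta_C p \<theta> \<and> I \<in> rational_intervals \<and> 1 \<le> j \<and> 0 < \<epsilon>}"
  by (simp add: Theta_topology_def Theta_ball_def)

lemma openin_Theta_ball:
  assumes "f \<in> Theta_C p \<theta>" "I \<in> rational_intervals" "1 \<le> j" "0 < \<epsilon>"
  shows "openin (Theta_topology p \<theta>) (Theta_ball p \<theta> I j f \<epsilon>)"
  unfolding Theta_topology_eq by (rule topology_generated_by_Basis) (use assms in blast)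

text \<open>Write \<open>g_t\<close> for the translate of \<open>g\<close> by \<open>t\<close>. Let \<open>h\<close> be a representative of the image of
  \<open>(t0, A0)\<close> in the given ball. Its translate \<open>g0\<close> by \<open>- t0\<close> represents \<open>A0\<close>, and for a
  representative \<open>g\<close> of \<open>A\<close>,
  \<open>g_t - f = (g - g0)_t + (h_(t - t0) - h) + (h - f)\<close>. A ball around \<open>g0\<close> for an interval that
  contains \<open>I\<close> and all \<open>I + t\<close> with \<open>t\<close> near \<open>t0\<close> controls the first term, continuity in time
  the second. Pulling \<open>h\<close> back, rather than starting from some representative of \<open>A0\<close>, avoids any
  comparison of the seminorms of different representatives.\<close>

lemma translation_map_neighbourhood:
  fixes f :: "real \<times> (real^'n) \<Rightarrow> real^'m"
  assumes p: "1 \<le> p" and \<theta>: "suitable_moduli \<theta>" and f: "f \<in> Theta_C p \<theta>"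
    and I: "I \<in> rational_intervals" and j: "1 \<le> j"
    and A0: "A0 \<in> Theta_C p \<theta> // Theta_rel p \<theta>"
    and ball: "translation_map p \<theta> (t0, A0) \<in> Theta_ball p \<theta> I j f \<epsilon>"
  obtains \<delta> V where "0 < \<delta>" "openin (Theta_topology p \<theta>) V" "A0 \<in> V"
    "\<And>t A. \<bar>t - t0\<bar> < \<delta> \<Longrightarrow> A \<in> V \<Longrightarrow> translation_map p \<theta> (t, A) \<in> Theta_ball p \<theta> I j f \<epsilon>"
proof -
  have p0: "0 \<le> p" using p by simp
  obtain a b where ab: "I = {a..b}" "a \<le> b" using I by (auto simp: rational_intervals_def)
  note I' = I[unfolded ab(1)]
  let ?S = "Theta_seminorm p \<theta> {a..b} j"
  obtain f0 where f0: "f0 \<in> Theta_C p \<theta>" "A0 = Theta_class p \<theta> f0"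
    using A0 by (rule Theta_quotientE)
  obtain h where h: "h \<in> translation_map p \<theta> (t0, A0)" and hf: "?S (\<lambda>z. h z - f z) < \<epsilon>"
    using ball unfolding Theta_ball_def ab(1) by blast
  have rel: "(time_translate t0 f0, h) \<in> Theta_rel p \<theta>"
    using h translation_map_Theta_class[OF p \<theta> f0(1)] by (simp add: f0(2) mem_Theta_class_iff)
  then have hC: "h \<in> Theta_C p \<theta>" by (simp add: Theta_rel_def)
  define g0 where "g0 = time_translate (- t0) h"
  have g0C: "g0 \<in> Theta_C p \<theta>" unfolding g0_def by (rule Theta_C_translate[OF p \<theta> hC])
  have "g0 \<in> A0"
    using Theta_rel_translate[OF p \<theta> rel, of "- t0"]
    by (simp add: f0(2) mem_Theta_class_iff g0_def time_translate_time_translate)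
  define \<eta> where "\<eta> = (\<epsilon> - ?S (\<lambda>z. h z - f z)) / 3"
  have \<eta>: "0 < \<eta>" using hf by (simp add: \<eta>_def)
  obtain \<delta>0 where \<delta>0: "0 < \<delta>0"
    "\<And>t. \<bar>t\<bar> < \<delta>0 \<Longrightarrow> ?S (\<lambda>z. time_translate t h z - h z) \<le> \<eta>"
    using Theta_seminorm_translate_small[OF p \<theta> hC I' ab(2) j \<eta>] by blast
  obtain c d where cd: "{c..d} \<in> rational_intervals" "c \<le> min a (a + t0 - 1)" "max b (b + t0 + 1) \<le> d" "c \<le> d"
    by (rule rational_interval_superset)
  define V where "V = Theta_ball p \<theta> {c..d} j g0 \<eta>"
  define \<delta> where "\<delta> = min 1 \<delta>0"
  show thesis
  proof (rule that)
    show "0 < \<delta>" using \<delta>0(1) by (simp add: \<delta>_def)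
    show "openin (Theta_topology p \<theta>) V"
      unfolding V_def by (rule openin_Theta_ball[OF g0C cd(1) j \<eta>])
    have "Theta_seminorm p \<theta> {c..d} j (\<lambda>z. g0 z - g0 z) \<le> 0"
      by (rule Theta_seminorm_le[OF p \<theta> cd(1) j]) (simp_all add: set_lebesgue_integral_def)
    with \<eta> have "Theta_seminorm p \<theta> {c..d} j (\<lambda>z. g0 z - g0 z) < \<eta>" by (rule order.strict_trans1[rotated])
    then show "A0 \<in> V"
      unfolding V_def Theta_ball_def using A0 \<open>g0 \<in> A0\<close> by blast
    fix t A assume t: "\<bar>t - t0\<bar> < \<delta>" and A: "A \<in> V"
    obtain g where gA: "g \<in> A" and gg0: "Theta_seminorm p \<theta> {c..d} j (\<lambda>z. g z - g0 z) < \<eta>"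
      and AQ: "A \<in> Theta_C p \<theta> // Theta_rel p \<theta>"
      using A unfolding V_def Theta_ball_def by blast
    obtain g1 where g1: "g1 \<in> Theta_C p \<theta>" "A = Theta_class p \<theta> g1"
      using AQ by (rule Theta_quotientE)
    then have g1g: "(g1, g) \<in> Theta_rel p \<theta>" using gA by (simp add: mem_Theta_class_iff)
    then have gC: "g \<in> Theta_C p \<theta>" by (simp add: Theta_rel_def)
    have Ag: "A = Theta_class p \<theta> g" using g1 g1g gC by (simp add: Theta_class_eq_iff)
    note gtC = Theta_C_translate[OF p \<theta> gC, of t]
    have image: "translation_map p \<theta> (t, A) = Theta_class p \<theta> (time_translate t g)"
      unfolding Ag by (rule translation_map_Theta_class[OF p \<theta> gC])
    have sub: "{a..b} \<subseteq> {c..d}" "{a + t..b + t} \<subseteq> {c..d}"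
      using cd t by (auto simp: \<delta>_def)
    note dom = gC[THEN Theta_C_imp_Lp_dominated] g0C[THEN Theta_C_imp_Lp_dominated]
      hC[THEN Theta_C_imp_Lp_dominated] f[THEN Theta_C_imp_Lp_dominated]
    define u where "u = time_translate t (\<lambda>z. g z - g0 z)"
    define v where "v z = time_translate (t - t0) h z - h z" for z
    define w where "w z = h z - f z" for z
    have ud: "u \<in> Lp_dominated p" and vd: "v \<in> Lp_dominated p" and wd: "w \<in> Lp_dominated p"
      unfolding u_def v_def[abs_def] w_def[abs_def]
      by (intro Lp_dominated_translate Lp_dominated_diff p0 dom)+
    have "?S u \<le> Theta_seminorm p \<theta> {c..d} j (\<lambda>z. g z - g0 z)"
      unfolding u_def by (intro Theta_seminorm_translate_le[OF p \<theta> j I' ab(2) cd(1) sub]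
          Lp_dominated_diff p0 dom)
    then have u: "?S u < \<eta>" using gg0 by simp
    have v: "?S v \<le> \<eta>"
      using \<delta>0(2)[of "t - t0"] t by (simp add: v_def[abs_def] \<delta>_def)
    have "time_translate t g0 = time_translate (t - t0) h"
      by (simp add: g0_def time_translate_time_translate)
    then have split: "(\<lambda>z. time_translate t g z - f z) = (\<lambda>z. (u z + v z) + w z)"
      by (auto simp: u_def v_def w_def fun_eq_iff time_translate_def)
    have "?S (\<lambda>z. time_translate t g z - f z) \<le> ?S (\<lambda>z. u z + v z) + ?S w"
      unfolding split
      by (rule Theta_seminorm_triangle[OF p \<theta> I' j Lp_dominated_add[OF p0 ud vd] wd ab(2)])
    also have "\<dots> \<le> ?S u + ?S v + ?S w"
      using Theta_seminorm_triangle[OF p \<theta> I' j ud vd ab(2)] by simp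
    also have "\<dots> < \<epsilon>"
      using u v \<eta> by (simp add: \<eta>_def w_def[abs_def] field_simps)
    finally show "translation_map p \<theta> (t, A) \<in> Theta_ball p \<theta> I j f \<epsilon>"
      unfolding Theta_ball_def image ab(1)
      using Theta_class_in_quotient[OF gtC] mem_Theta_class_self[OF gtC] by blast
  qed
qed

lemma translation_map_in_quotient:
  fixes A :: "(real \<times> (real^'n) \<Rightarrow> real^'m) set"
  assumes "1 \<le> p" "suitable_moduli \<theta>" "A \<in> Theta_C p \<theta> // Theta_rel p \<theta>"
  shows "translation_map p \<theta> (t, A) \<in> Theta_C p \<theta> // Theta_rel p \<theta>"
  using assms(3)
proof (rule Theta_quotientE)
  fix f assume f: "f \<in> Theta_C p \<theta>" "A = Theta_class p \<theta> f"
  then show ?thesis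
    using translation_map_Theta_class[OF assms(1,2) f(1), of t] Theta_C_translate[OF assms(1,2) f(1), of t]
    by (simp add: Theta_class_in_quotient)
qed

lemma continuous_map_translation_map:
  fixes p :: real
  assumes p: "1 \<le> p" and \<theta>: "suitable_moduli \<theta>"
  defines "X \<equiv> Theta_topology p \<theta> :: (real \<times> (real^'n) \<Rightarrow> real^'m) set topology"
  shows "continuous_map (prod_topology euclideanreal X) X (translation_map p \<theta>)"
proof -
  have top: "topspace X = Theta_C p \<theta> // Theta_rel p \<theta>"
    unfolding X_def by (rule topspace_Theta_topology[OF \<theta>])
  let ?\<B> = "{Theta_ball p \<theta> I j f \<epsilon> | (f :: real \<times> (real^'n) \<Rightarrow> real^'m) I j \<epsilon>.
    f \<in> Theta_C p \<theta> \<and> I \<in> rational_intervals \<and> 1 \<le> j \<and> 0 < \<epsilon>}"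
  have XB: "X = topology_generated_by ?\<B>" unfolding X_def by (rule Theta_topology_eq)
  have "continuous_map (prod_topology euclideanreal X) (topology_generated_by ?\<B>) (translation_map p \<theta>)"
  proof (rule continuous_on_generated_topo)
    fix U assume "U \<in> ?\<B>"
    then obtain f I j \<epsilon> where U: "U = Theta_ball p \<theta> I j f \<epsilon>" and f: "f \<in> Theta_C p \<theta>"
      and I: "I \<in> rational_intervals" and j: "1 \<le> j" by blast
    let ?P = "translation_map p \<theta> -` U \<inter> topspace (prod_topology euclideanreal X)"
    show "openin (prod_topology euclideanreal X) ?P"
      unfolding openin_prod_topology_alt
    proof (intro allI impI)
      fix t0 A0 assume "(t0, A0) \<in> ?P"
      then have A0: "A0 \<in> Theta_C p \<theta> // Theta_rel p \<theta>"
        and ball: "translation_map p \<theta> (t0, A0) \<in> Theta_ball p \<theta> I j f \<epsilon>"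
        by (auto simp: top U)
      obtain \<delta> V where \<delta>: "0 < \<delta>" and V: "openin X V" "A0 \<in> V"
        and VU: "\<And>t A. \<bar>t - t0\<bar> < \<delta> \<Longrightarrow> A \<in> V \<Longrightarrow> translation_map p \<theta> (t, A) \<in> U"
        unfolding U X_def using translation_map_neighbourhood[OF p \<theta> f I j A0 ball] by blast
      have "ball t0 \<delta> \<times> V \<subseteq> ?P"
        using VU openin_subset[OF V(1)] by (auto simp: dist_real_def abs_minus_commute)
      then show "\<exists>W V. openin euclideanreal W \<and> openin X V \<and> t0 \<in> W \<and> A0 \<in> V \<and> W \<times> V \<subseteq> ?P"
        using \<delta> V by (intro exI[of _ "ball t0 \<delta>"] exI[of _ V]) auto
    qed
  next
    have "\<Union>?\<B> = topspace X" unfolding XB by (simp add: topology_generated_by_topspace)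
    then show "translation_map p \<theta> ` topspace (prod_topology euclideanreal X) \<subseteq> \<Union>?\<B>"
      using translation_map_in_quotient[OF p \<theta>] by (auto simp: top)
  qed
  then show ?thesis using XB by simp
qed

theorem theorem3p1:
  fixes p :: real
    and \<theta> :: "real set \<Rightarrow> nat \<Rightarrow> real \<Rightarrow> real"
  assumes "1 \<le> p"
    and "suitable_moduli \<theta>"
  shows "(\<forall>t. \<forall>f \<in> (Theta_C p \<theta> :: (real \<times> (real^'n::finite) \<Rightarrow> real^'m::finite) set).
            time_translate t f \<in> Theta_C p \<theta> \<and>
            translation_map p \<theta> (t, Theta_class p \<theta> f) = Theta_class p \<theta> (time_translate t f))
       \<and> continuous_flow
            (Theta_topology p \<theta> :: (real \<times> (real^'n::finite) \<Rightarrow> real^'m::finite) set topology)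
            (translation_map p \<theta>)"
proof -
  note trans = Theta_C_translate[OF assms] and image_class = translation_map_Theta_class[OF assms]
  let ?X = "Theta_topology p \<theta> :: (real \<times> (real^'n) \<Rightarrow> real^'m) set topology"
  have "translation_map p \<theta> (0, A) = A"
    and "translation_map p \<theta> (t + s, A) = translation_map p \<theta> (t, translation_map p \<theta> (s, A))"
    if A: "A \<in> topspace ?X" for t s A
  proof -
    obtain f where f: "f \<in> Theta_C p \<theta>" "A = Theta_class p \<theta> f"
      using A unfolding topspace_Theta_topology[OF assms(2)] by (rule Theta_quotientE)
    show "translation_map p \<theta> (0, A) = A"
      using image_class[OF f(1), of 0] by (simp add: f(2))
    show "translation_map p \<theta> (t + s, A) = translation_map p \<theta> (t, translation_map p \<theta> (s, A))"
      by (simp add: f image_class trans time_translate_time_translate)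
  qed
  then have "continuous_flow ?X (translation_map p \<theta>)"
    unfolding continuous_flow_def using continuous_map_translation_map[OF assms] by blast
  then show ?thesis using trans image_class by blast
qed

end
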